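(* Let $V_a\in\Xi$ be mutually commuting vector fields on a manifold $\mathcal{M}$, let $\theta^{ab}$ be a constant antisymmetric matrix, and let $(\Xi_\star,[\cdot,\cdot]_\star)$ be the $\star$-Lie algebra of vector fields deformed by the twist $\mathcal{F}_V=\exp\bigl(-\tfrac{i\lambda}{2}\theta^{ab}V_a\otimes V_b\bigr)$. Let $\mathfrak{g}\subseteq\Xi$ be a finite-dimensional Lie subalgebra with basis $\{t_i\}$ and $[t_i,t_j]=f_{ij}^{\ \ k}t_k$, and suppose $[V_a,\mathfrak{g}]\subseteq\mathfrak{g}$ for all $a$. Then choosing $t_i^\star=t_i$ for all $i$ yields a $\star$-Lie subalgebra $(\mathfrak{g}_\star,[\cdot,\cdot]_\star)\subseteq(\Xi_\star,[\cdot,\cdot]_\star)$, $\mathfrak{g}_\star=\mathrm{span}(t_i^\star)$. In particular $\mathfrak{g}_\star=\mathfrak{g}$ as vector spaces, and $[t_i,t_j]_\star=f_{ij}^{\star\,m}t_m$ with $$f_{ij}^{\star\,m}=\Theta^{\beta_{(n)}\alpha_{(n)}}\,\mathcal{N}^{k}_{\beta_{(n)}i}\,\mathcal{N}^{l}_{\alpha_{(n)}j}\,f_{kl}^{\ \ m},$$ where the sum runs over all $n\ge0$ and all multi-indices $\alpha_{(n)}=(a_1,\dots,a_n)$, $\beta_{(n)}=(b_1,\dots,b_n)$ (and over $k,l$), $\Theta^{\beta_{(n)}\alpha_{(n)}}=\frac{1}{n!}\bigl(\frac{i\lambda}{2}\bigr)^n\theta^{b_1a_1}\cdots\theta^{b_na_n}$,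 the constants $\mathcal{N}_{ai}^{j}$ are defined by $[V_a,t_i]=\mathcal{N}_{ai}^{j}t_j$, and $\mathcal{N}^{j}_{\alpha_{(n)}i}=(\mathcal{N}_{a_n}\cdots\mathcal{N}_{a_1})_i^{\,j}$, i.e. $[V_{a_1},\cdots[V_{a_n},t_i]\cdots]=\mathcal{N}^{j}_{\alpha_{(n)}i}t_j$.
   Context: $\Xi$ is the Lie algebra of smooth vector fields on $\mathcal{M}$, $U\Xi$ its universal enveloping algebra with the usual Hopf structure ($\Delta(u)=u\otimes1+1\otimes u$, $\epsilon(u)=0$, $S(u)=-u$ for $u\in\Xi$). Everything is over formal power series in $\lambda$ (spans over $\mathbb{C}[[\lambda]]$, tensor products $\lambda$-adically completed). Repeated indices are summed. $U\Xi$ acts on $U\Xi$ by the adjoint action, written $\xi(u)$; for $V,u\in\Xi$, $V(u)=[V,u]$. Notation: $\mathcal{F}=f^\alpha\otimes f_\alpha$, $\mathcal{F}^{-1}=\bar f^\alpha\otimes\bar f_\alpha$ ($=\exp(\frac{i\lambda}{2}\theta^{ab}V_a\otimes V_b)$ here), $\mathcal{F}_{21}=f_\alpha\otimes f^\alpha$, $R=\mathcal{F}_{21}\mathcal{F}^{-1}$, $R^{-1}=\bar R^\alpha\otimes\bar R_\alpha$, $\chi=f^\alpha S(f_\alpha)$, $X_\xi=\bar f^\alpha\xi\chi S^{-1}(\bar f_\alpha)$. The $\star$-Lie algebra of vector fields is $\Xi_\star=\Xi$ as a vector space with $[u,v]_\star=[\bar f^\alpha(u),\bar f_\alpha(v)]$.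 $U\Xi_\star=U\Xi$ as a vector space, with product $\xi\star\eta=\bar f^\alpha(\xi)\bar f_\alpha(\eta)$ and coproduct $\Delta_\star(u)=u\otimes1+X_{\bar R^\alpha}\otimes\bar R_\alpha(u)$ for $u\in\Xi$. A $\star$-Lie subalgebra $\mathfrak{g}_\star=\mathrm{span}(t_i^\star)$ deforming $\mathfrak{g}$ (with $t_i^\star=t_i+\mathcal{O}(\lambda)$) means: (a) $[\mathfrak{g}_\star,\mathfrak{g}_\star]_\star\subseteq\mathfrak{g}_\star$ with structure constants equal to $f_{ij}^{\ \ k}+\mathcal{O}(\lambda)$; (b) $\Delta_\star(\mathfrak{g}_\star)\subseteq\mathfrak{g}_\star\otimes1+U\Xi_\star\otimes\mathfrak{g}_\star$. *)

theory Defs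
  imports
    "HOL-Analysis.Abstract_Euclidean_Space"
    "HOL-Analysis.Derivative"
    "HOL-Library.Poly_Mapping"
    "HOL-Computational_Algebra.Formal_Power_Series"
begin

class complex_vector = ab_group_add +
  fixes scaleC :: "complex \<Rightarrow> 'a \<Rightarrow> 'a" (infixr \<open>*\<^sub>C\<close> 73)
  assumes scaleC_add_right: "c *\<^sub>C (x + y) = c *\<^sub>C x + c *\<^sub>C y"
    and scaleC_add_left: "(c + d) *\<^sub>C x = c *\<^sub>C x + d *\<^sub>C x"
    and scaleC_scaleC: "c *\<^sub>C d *\<^sub>C x = (c * d) *\<^sub>C x"
    and scaleC_one: "1 *\<^sub>C x = x"

global_interpretation complex_vector: vector_space "scaleC :: complex \<Rightarrow> 'a \<Rightarrow> 'a::complex_vector"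
  by unfold_locales (simp_all add: scaleC_add_right scaleC_add_left scaleC_scaleC scaleC_one)

lemmas scaleC_simps [simp] =
  complex_vector.scale_zero_left complex_vector.scale_zero_right complex_vector.scale_one
  complex_vector.scale_minus_left complex_vector.scale_minus_right

class complex_algebra_1 = complex_vector + ring_1 +
  assumes mult_scaleC_left: "(c *\<^sub>C x) * y = c *\<^sub>C (x * y)"
    and mult_scaleC_right: "x * (c *\<^sub>C y) = c *\<^sub>C (x * y)"

instantiation complex :: complex_algebra_1
begin
definition scaleC_complex :: "complex \<Rightarrow> complex \<Rightarrow> complex" where [simp]: "scaleC_complex = (*)"
instance by standard (simp_all add: algebra_simps)
end

definition clinear :: "('a::complex_vector \<Rightarrow> 'b::complex_vector) \<Rightarrow> bool" where
  "clinear f \<longleftrightarrow> (\<forall>x y. f (x + y) = f x + f y) \<and> (\<forall>c x. f (c *\<^sub>C x) = c *\<^sub>C f x)"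

definition cbilinear :: "('a::complex_vector \<Rightarrow> 'b::complex_vector \<Rightarrow> 'c::complex_vector) \<Rightarrow> bool" where
  "cbilinear B \<longleftrightarrow> (\<forall>x. clinear (B x)) \<and> (\<forall>y. clinear (\<lambda>x. B x y))"

lemma clinear_add: "clinear f \<Longrightarrow> f (x + y) = f x + f y"
  by (simp add: clinear_def)

lemma clinear_scaleC: "clinear f \<Longrightarrow> f (c *\<^sub>C x) = c *\<^sub>C f x"
  by (simp add: clinear_def)

lemma clinearI:
  "(\<And>x y. f (x + y) = f x + f y) \<Longrightarrow> (\<And>c x. f (c *\<^sub>C x) = c *\<^sub>C f x) \<Longrightarrow> clinear f"
  by (simp add: clinear_def)

lemma clinear_zero: "clinear f \<Longrightarrow> f 0 = 0"
proof -
  assume "clinear f"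
  then have "f (0 *\<^sub>C 0) = 0 *\<^sub>C f 0" unfolding clinear_def by blast
  then show ?thesis by simp
qed

lemma clinear_uminus: "clinear f \<Longrightarrow> f (- x) = - f x"
proof -
  assume "clinear f"
  then have "f ((- 1) *\<^sub>C x) = (- 1) *\<^sub>C f x" unfolding clinear_def by blast
  then show ?thesis by simp
qed

lemma clinear_diff: "clinear f \<Longrightarrow> f (x - y) = f x - f y"
  by (simp only: diff_conv_add_uminus clinear_uminus[symmetric]) (simp only: clinear_def)

text \<open>Finitely supported functions \<^typ>\<open>'k \<Rightarrow>\<^sub>0 complex\<close> are the free complex vector space on \<^typ>\<open>'k\<close>.\<close>

instantiation poly_mapping :: (type, complex_vector) complex_vector
begin

lift_definition scaleC_poly_mapping :: "complex \<Rightarrow> ('a \<Rightarrow>\<^sub>0 'b) \<Rightarrow> 'a \<Rightarrow>\<^sub>0 'b" is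
  "\<lambda>c f k. c *\<^sub>C f k"
  by (rule finite_subset[rotated]) auto

instance
  by standard (transfer; simp add: fun_eq_iff scaleC_add_right scaleC_add_left scaleC_scaleC)+

end

lemma lookup_scaleC [simp]: "Poly_Mapping.lookup (c *\<^sub>C p) k = c *\<^sub>C Poly_Mapping.lookup p k"
  by transfer simp

lemma scaleC_single: "c *\<^sub>C Poly_Mapping.single k d = Poly_Mapping.single k (c *\<^sub>C d)"
  by (rule poly_mapping_eqI) (simp add: lookup_single when_def)

definition lin_ext :: "('k \<Rightarrow> 'w::complex_vector) \<Rightarrow> ('k \<Rightarrow>\<^sub>0 complex) \<Rightarrow> 'w" where
  "lin_ext f p = (\<Sum>k\<in>Poly_Mapping.keys p. Poly_Mapping.lookup p k *\<^sub>C f k)"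

lemma lin_ext_superset:
  assumes "finite A" "Poly_Mapping.keys p \<subseteq> A"
  shows "lin_ext f p = (\<Sum>k\<in>A. Poly_Mapping.lookup p k *\<^sub>C f k)"
  unfolding lin_ext_def
  by (rule sum.mono_neutral_left) (use assms in \<open>auto simp: in_keys_iff\<close>)

lemma clinear_lin_ext: "clinear (lin_ext f)"
  unfolding clinear_def
proof (intro conjI allI)
  fix p q :: "'a \<Rightarrow>\<^sub>0 complex" and c
  let ?A = "Poly_Mapping.keys p \<union> Poly_Mapping.keys q"
  have "lin_ext f (p + q) = (\<Sum>k\<in>?A. Poly_Mapping.lookup (p + q) k *\<^sub>C f k)"
    by (rule lin_ext_superset) (auto dest: subsetD[OF Poly_Mapping.keys_add])
  also have "\<dots> = lin_ext f p + lin_ext f q"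
    by (simp add: lookup_add scaleC_add_left sum.distrib lin_ext_superset[of ?A])
  finally show "lin_ext f (p + q) = lin_ext f p + lin_ext f q" .
  have "lin_ext f (c *\<^sub>C p) = (\<Sum>k\<in>Poly_Mapping.keys p. Poly_Mapping.lookup (c *\<^sub>C p) k *\<^sub>C f k)"
    by (rule lin_ext_superset) (auto simp: in_keys_iff)
  also have "\<dots> = c *\<^sub>C lin_ext f p"
    by (simp add: lin_ext_def complex_vector.scale_sum_right)
  finally show "lin_ext f (c *\<^sub>C p) = c *\<^sub>C lin_ext f p" .
qed

lemma lin_ext_single [simp]: "lin_ext f (Poly_Mapping.single k c) = c *\<^sub>C f k"
  by (cases "c = 0") (simp_all add: lin_ext_def)

lemma free_induct [case_names single add]:
  assumes "\<And>k c. P (Poly_Mapping.single k c)" and "\<And>p q. P p \<Longrightarrow> P q \<Longrightarrow> P (p + q)"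
  shows "P (p :: 'k \<Rightarrow>\<^sub>0 'b::comm_monoid_add)"
proof -
  have *: "P (\<Sum>k\<in>A. Poly_Mapping.single k (Poly_Mapping.lookup p k))" if "finite A" for A
    using that
  proof induction
    case empty
    show ?case using assms(1)[of undefined 0] by simp
  qed (use assms in auto)
  have "(\<Sum>k\<in>Poly_Mapping.keys p. Poly_Mapping.single k (Poly_Mapping.lookup p k)) = p"
    by (rule poly_mapping_eqI)
      (simp add: lookup_sum lookup_single when_def in_keys_iff)
  then show ?thesis using *[OF finite_keys, of p] by simp
qed

lemma clinear_eq_on_single:
  assumes "clinear f" "clinear g" "\<And>k. f (Poly_Mapping.single k (1::complex)) = g (Poly_Mapping.single k 1)"
  shows "f p = g p"
proof (induction p rule: free_induct)
  case (single k c)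
  have c: "Poly_Mapping.single k c = c *\<^sub>C Poly_Mapping.single k (1::complex)"
    by (simp add: scaleC_single)
  show ?case unfolding c using assms by (simp only: clinear_def)
qed (use assms in \<open>simp add: clinear_def\<close>)

instance poly_mapping :: (monoid_add, complex_algebra_1) complex_algebra_1
proof
  fix c and p q :: "'a \<Rightarrow>\<^sub>0 'b"
  have A: "c *\<^sub>C p = Poly_Mapping.single 0 (c *\<^sub>C 1) * p" for p :: "'a \<Rightarrow>\<^sub>0 'b"
  proof -
    have "Poly_Mapping.map ((*) (c *\<^sub>C 1)) p = c *\<^sub>C p"
      by (rule poly_mapping_eqI) (simp add: Poly_Mapping.map.rep_eq when_def mult_scaleC_left)
    then show ?thesis by (simp add: mult_map_scale_conv_mult)
  qed
  show "(c *\<^sub>C p) * q = c *\<^sub>C (p * q)"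
    by (simp add: A mult.assoc)
  have "p * Poly_Mapping.single 0 (c *\<^sub>C 1) = Poly_Mapping.single 0 (c *\<^sub>C 1) * p"
    for p :: "'a \<Rightarrow>\<^sub>0 'b"
  proof (induction p rule: free_induct)
    case (single k v)
    then show ?case by (simp add: mult_single mult_scaleC_left mult_scaleC_right)
  next
    case (add p q)
    then show ?case by (simp add: algebra_simps)
  qed
  then show "p * (c *\<^sub>C q) = c *\<^sub>C (p * q)"
    by (simp add: A mult.assoc[symmetric])
qed


class complex_lie_algebra = complex_vector +
  fixes bracket :: "'a \<Rightarrow> 'a \<Rightarrow> 'a"
  assumes bracket_add_left: "bracket (x + y) z = bracket x z + bracket y z"
    and bracket_add_right: "bracket x (y + z) = bracket x y + bracket x z"
    and bracket_scaleC_left: "bracket (c *\<^sub>C x) y = c *\<^sub>C bracket x y"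
    and bracket_scaleC_right: "bracket x (c *\<^sub>C y) = c *\<^sub>C bracket x y"
    and bracket_self: "bracket x x = 0"
    and jacobi: "bracket x (bracket y z) + bracket y (bracket z x) + bracket z (bracket x y) = 0"

lemma bracket_swap: "bracket x y = - bracket y x"
proof -
  have "bracket (x + y) (x + y) = 0" by (rule bracket_self)
  then have "bracket x y + bracket y x = 0"
    by (simp add: bracket_add_left bracket_add_right bracket_self[of x] bracket_self[of y] add.commute)
  then show ?thesis by (rule eq_neg_iff_add_eq_0[THEN iffD2])
qed

lemma bracket_bracket:
  "bracket (bracket x y) z = bracket x (bracket y z) - bracket y (bracket x z)"
proof -
  have "bracket (bracket x y) z = - bracket z (bracket x y)" by (rule bracket_swap)
  moreover have "bracket y (bracket z x) = - bracket y (bracket x z)"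
    using bracket_scaleC_right[of y "-1" "bracket x z"] bracket_swap[of z x] by simp
  moreover have "bracket x (bracket y z) + bracket y (bracket z x) = - bracket z (bracket x y)"
    using jacobi[of x y z] by (rule eq_neg_iff_add_eq_0[THEN iffD2])
  ultimately show ?thesis by simp
qed

datatype 'l word = Word (letters: "'l list")

instantiation word :: (type) monoid_add
begin
definition zero_word_def: "0 = Word []"
definition plus_word_def: "u + v = Word (letters u @ letters v)"
instance by standard (auto simp: zero_word_def plus_word_def)
end

text \<open>Words are written additively so that \<^typ>\<open>'l word \<Rightarrow>\<^sub>0 complex\<close> is the free associative algebra.\<close>

definition free_gen :: "'l \<Rightarrow> 'l word \<Rightarrow>\<^sub>0 complex" where
  "free_gen x = Poly_Mapping.single (Word [x]) 1"

inductive_set uea_ideal :: "('l::complex_lie_algebra word \<Rightarrow>\<^sub>0 complex) set" where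
  add_gen: "free_gen (x + y) - free_gen x - free_gen y \<in> uea_ideal"
| scaleC_gen: "free_gen (c *\<^sub>C x) - c *\<^sub>C free_gen x \<in> uea_ideal"
| bracket_gen: "free_gen x * free_gen y - free_gen y * free_gen x - free_gen (bracket x y) \<in> uea_ideal"
| add: "p \<in> uea_ideal \<Longrightarrow> q \<in> uea_ideal \<Longrightarrow> p + q \<in> uea_ideal"
| mult: "p \<in> uea_ideal \<Longrightarrow> r * p * s \<in> uea_ideal"

lemma uea_ideal_zero: "0 \<in> uea_ideal"
  using uea_ideal.mult[OF uea_ideal.add_gen, of 0 _ _ 0] by simp

lemma uea_ideal_mult_left: "p \<in> uea_ideal \<Longrightarrow> r * p \<in> uea_ideal"
  using uea_ideal.mult[of p r 1] by simp

lemma uea_ideal_mult_right: "p \<in> uea_ideal \<Longrightarrow> p * s \<in> uea_ideal"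
  using uea_ideal.mult[of p 1 s] by simp

lemma uea_ideal_scaleC: "p \<in> uea_ideal \<Longrightarrow> c *\<^sub>C p \<in> uea_ideal"
  using uea_ideal_mult_left[of p "c *\<^sub>C 1"] by (simp add: mult_scaleC_left)

lemma uea_ideal_uminus: "p \<in> uea_ideal \<Longrightarrow> - p \<in> uea_ideal"
  using uea_ideal_scaleC[of p "-1"] by simp

lemma uea_ideal_diff: "p \<in> uea_ideal \<Longrightarrow> q \<in> uea_ideal \<Longrightarrow> p - q \<in> uea_ideal"
  using uea_ideal.add[OF _ uea_ideal_uminus, of p q] by simp

definition uea_rel :: "('l::complex_lie_algebra word \<Rightarrow>\<^sub>0 complex) \<Rightarrow> ('l word \<Rightarrow>\<^sub>0 complex) \<Rightarrow> bool" where
  "uea_rel p q \<longleftrightarrow> p - q \<in> uea_ideal"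

lemma uea_rel_refl: "p = q \<Longrightarrow> uea_rel p q"
  by (simp add: uea_rel_def uea_ideal_zero)

quotient_type (overloaded) 'l uea = "'l::complex_lie_algebra word \<Rightarrow>\<^sub>0 complex" / uea_rel
proof (rule equivpI)
  show "reflp uea_rel" by (rule reflpI) (simp add: uea_rel_def uea_ideal_zero)
  show "symp uea_rel"
    by (rule sympI) (auto simp: uea_rel_def dest: uea_ideal_uminus)
  show "transp (uea_rel :: ('l word \<Rightarrow>\<^sub>0 complex) \<Rightarrow> _)"
  proof (rule transpI)
    fix p q r :: "'l word \<Rightarrow>\<^sub>0 complex"
    assume "uea_rel p q" "uea_rel q r"
    then have "(p - q) + (q - r) \<in> uea_ideal"
      unfolding uea_rel_def by (rule uea_ideal.add)
    then show "uea_rel p r" by (simp add: uea_rel_def)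
  qed
qed

lemma lookup_mult_word_0:
  "Poly_Mapping.lookup (p * q) (0 :: 'l word) = Poly_Mapping.lookup p 0 * Poly_Mapping.lookup q (0 :: 'l word)"
  for p q :: "'l word \<Rightarrow>\<^sub>0 complex"
proof (induction p rule: free_induct)
  case (single u c)
  show ?case
  proof (induction q rule: free_induct)
    case (single v d)
    show ?case
      by (cases u; cases v)
        (auto simp: mult_single lookup_single when_def zero_word_def plus_word_def)
  qed (simp add: lookup_add distrib_left)
qed (simp add: lookup_add distrib_right)

lemma lookup_free_gen_0: "Poly_Mapping.lookup (free_gen x) 0 = 0"
  by (simp add: free_gen_def lookup_single when_def zero_word_def)

lemma lookup_uea_ideal_0: "p \<in> uea_ideal \<Longrightarrow> Poly_Mapping.lookup p 0 = 0"
  by (induction rule: uea_ideal.induct)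
    (auto simp: lookup_minus lookup_add lookup_mult_word_0 lookup_free_gen_0)

instantiation uea :: (complex_lie_algebra) complex_algebra_1
begin

lift_definition zero_uea :: "'a uea" is 0 .
lift_definition one_uea :: "'a uea" is 1 .
lift_definition plus_uea :: "'a uea \<Rightarrow> 'a uea \<Rightarrow> 'a uea" is "(+)"
  unfolding uea_rel_def by (drule (1) uea_ideal.add) (simp add: algebra_simps)
lift_definition minus_uea :: "'a uea \<Rightarrow> 'a uea \<Rightarrow> 'a uea" is "(-)"
  unfolding uea_rel_def by (drule (1) uea_ideal_diff) (simp add: algebra_simps)
lift_definition uminus_uea :: "'a uea \<Rightarrow> 'a uea" is uminus
  unfolding uea_rel_def by (drule uea_ideal_uminus) (simp add: algebra_simps)
lift_definition times_uea :: "'a uea \<Rightarrow> 'a uea \<Rightarrow> 'a uea" is "(*)"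
proof -
  fix p p' q q' :: "'a word \<Rightarrow>\<^sub>0 complex"
  assume "uea_rel p p'" "uea_rel q q'"
  then have "p * (q - q') + (p - p') * q' \<in> uea_ideal"
    unfolding uea_rel_def by (intro uea_ideal.add uea_ideal_mult_left uea_ideal_mult_right)
  then show "uea_rel (p * q) (p' * q')"
    by (simp add: uea_rel_def algebra_simps)
qed
lift_definition scaleC_uea :: "complex \<Rightarrow> 'a uea \<Rightarrow> 'a uea" is "scaleC"
  unfolding uea_rel_def by (drule uea_ideal_scaleC) (simp add: complex_vector.scale_right_diff_distrib)

instance
proof
  show "(0::'a uea) \<noteq> 1"
    by transfer (auto simp: uea_rel_def lookup_minus dest!: lookup_uea_ideal_0)
qed (transfer, rule uea_rel_refl,
    simp add: algebra_simps scaleC_add_left scaleC_add_right scaleC_scaleC mult_scaleC_left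
      mult_scaleC_right)+

end

lift_definition uea_inj :: "'l::complex_lie_algebra \<Rightarrow> 'l uea" is free_gen .

lemma clinear_uea_inj: "clinear uea_inj"
proof (rule clinearI)
  show "uea_inj (x + y) = uea_inj x + uea_inj y" for x y :: 'a
    by transfer (use uea_ideal.add_gen in \<open>simp add: uea_rel_def diff_diff_add\<close>)
  show "uea_inj (c *\<^sub>C x) = c *\<^sub>C uea_inj x" for c and x :: 'a
    by transfer (simp add: uea_rel_def uea_ideal.scaleC_gen)
qed

lemma uea_inj_bracket: "uea_inj (bracket x y) = uea_inj x * uea_inj y - uea_inj y * uea_inj x"
proof transfer
  fix x y :: 'a
  show "uea_rel (free_gen (bracket x y)) (free_gen x * free_gen y - free_gen y * free_gen x)"
    using uea_ideal_uminus[OF uea_ideal.bracket_gen[of x y]] by (simp add: uea_rel_def)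
qed

text \<open>\<open>S(x\<^sub>1 \<cdots> x\<^sub>n) = (- 1)\<^sup>n x\<^sub>n \<cdots> x\<^sub>1\<close>\<close>

definition free_antipode :: "('l word \<Rightarrow>\<^sub>0 complex) \<Rightarrow> 'l word \<Rightarrow>\<^sub>0 complex" where
  "free_antipode =
    lin_ext (\<lambda>w. Poly_Mapping.single (Word (rev (letters w))) ((- 1) ^ length (letters w)))"

lemma clinear_free_antipode: "clinear free_antipode"
  unfolding free_antipode_def by (rule clinear_lin_ext)

lemma free_antipode_mult: "free_antipode (p * q) = free_antipode q * free_antipode p"
proof (induction p rule: free_induct)
  case (single u c)
  show ?case
  proof (induction q rule: free_induct)
    case (single v d)
    then show ?case
      by (simp add: free_antipode_def mult_single scaleC_single plus_word_def power_add algebra_simps)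
  next
    case (add p q)
    then show ?case
      by (simp add: distrib_left distrib_right clinear_add[OF clinear_free_antipode])
  qed
next
  case (add p q)
  then show ?case
    by (simp add: distrib_left distrib_right clinear_add[OF clinear_free_antipode])
qed

lemma free_antipode_gen: "free_antipode (free_gen x) = - free_gen x"
  by (simp add: free_antipode_def free_gen_def scaleC_single single_uminus)

lemma free_antipode_ideal: "p \<in> uea_ideal \<Longrightarrow> free_antipode p \<in> uea_ideal"
proof (induction rule: uea_ideal.induct)
  case (add_gen x y)
  show ?case
    using uea_ideal_uminus[OF uea_ideal.add_gen[of x y]]
    by (simp add: clinear_add[OF clinear_free_antipode] clinear_diff[OF clinear_free_antipode] free_antipode_gen algebra_simps)
next
  case (scaleC_gen c x)
  show ?case
    using uea_ideal_uminus[OF uea_ideal.scaleC_gen[of c x]]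
    by (simp add: clinear_diff[OF clinear_free_antipode] clinear_scaleC[OF clinear_free_antipode]
        free_antipode_gen algebra_simps)
next
  case (bracket_gen x y)
  show ?case
    using uea_ideal_uminus[OF uea_ideal.bracket_gen[of x y]]
    by (simp add: clinear_add[OF clinear_free_antipode] clinear_diff[OF clinear_free_antipode] free_antipode_gen free_antipode_mult algebra_simps)
next
  case (add p q)
  then show ?case by (simp add: clinear_add[OF clinear_free_antipode] uea_ideal.add)
next
  case (mult p r s)
  then show ?case
    by (simp add: free_antipode_mult uea_ideal.mult flip: mult.assoc)
qed

lift_definition antipode :: "'l::complex_lie_algebra uea \<Rightarrow> 'l uea" is free_antipode
  unfolding uea_rel_def clinear_diff[OF clinear_free_antipode, symmetric]
  by (rule free_antipode_ideal)

lemma antipode_mult: "antipode (x * y) = antipode y * antipode x"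
  by transfer (simp add: free_antipode_mult uea_rel_def uea_ideal_zero)

lemma antipode_inj: "antipode (uea_inj x) = - uea_inj x"
  by transfer (simp add: free_antipode_gen uea_rel_def uea_ideal_zero)

text \<open>The adjoint action of the enveloping algebra, restricted to the Lie algebra:
  \<open>(x\<^sub>1 \<cdots> x\<^sub>n)(v) = [x\<^sub>1, \<dots> [x\<^sub>n, v]]\<close>.\<close>

definition free_act :: "('l::complex_lie_algebra word \<Rightarrow>\<^sub>0 complex) \<Rightarrow> 'l \<Rightarrow> 'l" where
  "free_act p v = lin_ext (\<lambda>w. foldr bracket (letters w) v) p"

lemma clinear_free_act_left: "clinear (\<lambda>p. free_act p v)"
  unfolding free_act_def by (rule clinear_lin_ext)

lemma clinear_foldr_bracket: "clinear (foldr bracket xs)"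
  by (induction xs)
    (simp_all add: clinear_def bracket_add_right bracket_scaleC_right)

lemma clinear_free_act_right: "clinear (free_act p)"
proof (induction p rule: free_induct)
  case (single w c)
  then show ?case
    using clinear_foldr_bracket[of "letters w"]
    by (simp add: free_act_def clinear_def scaleC_add_right scaleC_scaleC mult.commute)
next
  case (add p q)
  show ?case
    by (rule clinearI)
      (simp_all add: clinear_add[OF clinear_free_act_left] clinear_add[OF add(1)] clinear_add[OF add(2)]
        clinear_scaleC[OF add(1)] clinear_scaleC[OF add(2)] scaleC_add_right)
qed

lemma free_act_mult: "free_act (p * q) v = free_act p (free_act q v)"
proof (induction p rule: free_induct)
  case (single w c)
  show ?case
  proof (induction q rule: free_induct)
    case (single u d)
    then show ?case
      using clinear_foldr_bracket[of "letters w"]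
      by (simp add: free_act_def mult_single plus_word_def clinear_def scaleC_scaleC)
  next
    case (add p q)
    then show ?case
      by (simp add: distrib_left clinear_add[OF clinear_free_act_left] clinear_add[OF clinear_free_act_right])
  qed
next
  case (add p q)
  then show ?case
    by (simp add: distrib_right clinear_add[OF clinear_free_act_left])
qed

lemma free_act_gen [simp]: "free_act (free_gen x) v = bracket x v"
  by (simp add: free_act_def free_gen_def)

lemma free_act_ideal: "p \<in> uea_ideal \<Longrightarrow> free_act p v = 0"
proof (induction arbitrary: v rule: uea_ideal.induct)
  case (scaleC_gen c x)
  show ?case
    by (simp add: clinear_diff[OF clinear_free_act_left] clinear_scaleC[OF clinear_free_act_left]
        bracket_scaleC_left)
next
  case (add p q)
  then show ?case by (simp add: clinear_add[OF clinear_free_act_left])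
qed (simp_all add: clinear_diff[OF clinear_free_act_left] free_act_mult bracket_add_left
    bracket_bracket clinear_zero[OF clinear_free_act_right])

lift_definition uea_act :: "'l::complex_lie_algebra uea \<Rightarrow> 'l \<Rightarrow> 'l" is free_act
proof (rule ext)
  fix p q :: "'l word \<Rightarrow>\<^sub>0 complex" and v
  assume "uea_rel p q"
  then show "free_act p v = free_act q v"
    unfolding uea_rel_def by (drule_tac v = v in free_act_ideal) (simp add: clinear_diff[OF clinear_free_act_left])
qed

lemma uea_act_inj: "uea_act (uea_inj x) v = bracket x v"
  by transfer simp

lemma uea_act_one: "uea_act 1 v = v"
  by transfer (simp add: free_act_def zero_word_def flip: single_one)

lemma uea_act_mult: "uea_act (x * y) v = uea_act x (uea_act y v)"
  by (transfer fixing: v) (rule free_act_mult)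


datatype ('a, 'b) simple_tensor = Simple 'a 'b

instantiation simple_tensor :: (monoid_mult, monoid_mult) monoid_add
begin
definition zero_simple_tensor_def: "0 = Simple 1 1"
fun plus_simple_tensor where
  "plus_simple_tensor (Simple a b) (Simple c d) = Simple (a * c) (b * d)"
instance
proof
  fix x y z :: "('a, 'b) simple_tensor"
  show "x + y + z = x + (y + z)" by (cases x; cases y; cases z) (simp add: mult.assoc)
  show "0 + x = x" "x + 0 = x" by (cases x, simp add: zero_simple_tensor_def)+
qed
end

text \<open>The addition on \<^typ>\<open>('a, 'b) simple_tensor\<close> is the componentwise product, which makes
  \<^typ>\<open>('a, 'b) simple_tensor \<Rightarrow>\<^sub>0 complex\<close> a ring with
  \<open>(a \<otimes> b) (c \<otimes> d) = a c \<otimes> b d\<close>.\<close>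

definition free_tensor :: "'a \<Rightarrow> 'b \<Rightarrow> ('a, 'b) simple_tensor \<Rightarrow>\<^sub>0 complex" where
  "free_tensor a b = Poly_Mapping.single (Simple a b) 1"

inductive_set tensor_null :: "(('a::complex_vector, 'b::complex_vector) simple_tensor \<Rightarrow>\<^sub>0 complex) set" where
  add_left: "free_tensor (a + a') b - free_tensor a b - free_tensor a' b \<in> tensor_null"
| add_right: "free_tensor a (b + b') - free_tensor a b - free_tensor a b' \<in> tensor_null"
| scaleC_left: "free_tensor (c *\<^sub>C a) b - c *\<^sub>C free_tensor a b \<in> tensor_null"
| scaleC_right: "free_tensor a (c *\<^sub>C b) - c *\<^sub>C free_tensor a b \<in> tensor_null"
| add: "p \<in> tensor_null \<Longrightarrow> q \<in> tensor_null \<Longrightarrow> p + q \<in> tensor_null"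
| scaleC: "p \<in> tensor_null \<Longrightarrow> c *\<^sub>C p \<in> tensor_null"

lemma tensor_null_zero: "0 \<in> tensor_null"
  using tensor_null.scaleC[OF tensor_null.add_left, of 0] by simp

lemma tensor_null_uminus: "p \<in> tensor_null \<Longrightarrow> - p \<in> tensor_null"
  using tensor_null.scaleC[of p "-1"] by simp

lemma tensor_null_diff: "p \<in> tensor_null \<Longrightarrow> q \<in> tensor_null \<Longrightarrow> p - q \<in> tensor_null"
  using tensor_null.add[OF _ tensor_null_uminus, of p q] by simp

definition tensor_rel :: "(('a::complex_vector, 'b::complex_vector) simple_tensor \<Rightarrow>\<^sub>0 complex) \<Rightarrow>
    (('a, 'b) simple_tensor \<Rightarrow>\<^sub>0 complex) \<Rightarrow> bool" where
  "tensor_rel p q \<longleftrightarrow> p - q \<in> tensor_null"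

lemma tensor_rel_refl: "p = q \<Longrightarrow> tensor_rel p q"
  by (simp add: tensor_rel_def tensor_null_zero)

quotient_type (overloaded) ('a, 'b) tensor =
  "('a::complex_vector, 'b::complex_vector) simple_tensor \<Rightarrow>\<^sub>0 complex" / tensor_rel
proof (rule equivpI)
  show "reflp tensor_rel" by (rule reflpI) (simp add: tensor_rel_refl)
  show "symp tensor_rel"
    by (rule sympI) (auto simp: tensor_rel_def dest: tensor_null_uminus)
  show "transp (tensor_rel :: (('a, 'b) simple_tensor \<Rightarrow>\<^sub>0 complex) \<Rightarrow> _)"
  proof (rule transpI)
    fix p q r :: "('a, 'b) simple_tensor \<Rightarrow>\<^sub>0 complex"
    assume "tensor_rel p q" "tensor_rel q r"
    then have "(p - q) + (q - r) \<in> tensor_null"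
      unfolding tensor_rel_def by (rule tensor_null.add)
    then show "tensor_rel p r" by (simp add: tensor_rel_def)
  qed
qed

instantiation tensor :: (complex_vector, complex_vector) complex_vector
begin

lift_definition zero_tensor :: "('a, 'b) tensor" is 0 .
lift_definition plus_tensor :: "('a, 'b) tensor \<Rightarrow> ('a, 'b) tensor \<Rightarrow> ('a, 'b) tensor" is "(+)"
  unfolding tensor_rel_def by (drule (1) tensor_null.add) (simp add: algebra_simps)
lift_definition minus_tensor :: "('a, 'b) tensor \<Rightarrow> ('a, 'b) tensor \<Rightarrow> ('a, 'b) tensor" is "(-)"
  unfolding tensor_rel_def by (drule (1) tensor_null_diff) (simp add: algebra_simps)
lift_definition uminus_tensor :: "('a, 'b) tensor \<Rightarrow> ('a, 'b) tensor" is uminus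
  unfolding tensor_rel_def by (drule tensor_null_uminus) (simp add: algebra_simps)
lift_definition scaleC_tensor :: "complex \<Rightarrow> ('a, 'b) tensor \<Rightarrow> ('a, 'b) tensor" is scaleC
  unfolding tensor_rel_def by (drule tensor_null.scaleC) (simp add: complex_vector.scale_right_diff_distrib)

instance
  by standard (transfer, rule tensor_rel_refl,
    simp add: algebra_simps scaleC_add_left scaleC_add_right scaleC_scaleC)+

end

lift_definition tensor :: "'a::complex_vector \<Rightarrow> 'b::complex_vector \<Rightarrow> ('a, 'b) tensor" (infixr \<open>\<otimes>\<close> 72)
  is free_tensor .

lemma cbilinear_tensor: "cbilinear (\<otimes>)"
  unfolding cbilinear_def
proof (intro conjI allI clinearI)
  show "a \<otimes> (b + b') = a \<otimes> b + a \<otimes> b'" for a :: 'a and b b' :: 'b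
    by transfer (use tensor_null.add_right in \<open>simp add: tensor_rel_def diff_diff_add\<close>)
  show "(a + a') \<otimes> b = a \<otimes> b + a' \<otimes> b" for a a' :: 'a and b :: 'b
    by transfer (use tensor_null.add_left in \<open>simp add: tensor_rel_def diff_diff_add\<close>)
  show "a \<otimes> (c *\<^sub>C b) = c *\<^sub>C (a \<otimes> b)" for a :: 'a and b :: 'b and c
    by transfer (simp add: tensor_rel_def tensor_null.scaleC_right)
  show "(c *\<^sub>C a) \<otimes> b = c *\<^sub>C (a \<otimes> b)" for a :: 'a and b :: 'b and c
    by transfer (simp add: tensor_rel_def tensor_null.scaleC_left)
qed

text \<open>The map \<open>a \<otimes> b \<mapsto> B a b\<close>; it is independent of the representative when \<open>B\<close> is bilinear.\<close>

definition tensor_lift ::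
  "('a::complex_vector \<Rightarrow> 'b::complex_vector \<Rightarrow> 'w::complex_vector) \<Rightarrow> ('a, 'b) tensor \<Rightarrow> 'w" where
  "tensor_lift B x = lin_ext (case_simple_tensor B) (rep_tensor x)"

lemma lin_ext_tensor_null:
  assumes "cbilinear B" "p \<in> tensor_null"
  shows "lin_ext (case_simple_tensor B) p = 0"
proof -
  have l: "clinear (B a)" "clinear (\<lambda>a. B a b)" for a b
    using assms(1) by (auto simp: cbilinear_def)
  show ?thesis
    using assms(2)
    by induction
      (simp_all add: free_tensor_def clinear_diff[OF clinear_lin_ext] clinear_add[OF clinear_lin_ext]
        clinear_scaleC[OF clinear_lin_ext] clinear_add[OF l(1)] clinear_scaleC[OF l(1)]
        clinear_add[OF l(2)] clinear_scaleC[OF l(2)])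
qed

lemma tensor_lift_abs:
  assumes "cbilinear B"
  shows "tensor_lift B (abs_tensor p) = lin_ext (case_simple_tensor B) p"
proof -
  have "tensor_rel (rep_tensor (abs_tensor p)) p"
    by (rule Quotient3_rep_abs[OF Quotient3_tensor]) (simp add: tensor_rel_refl)
  then have "lin_ext (case_simple_tensor B) (rep_tensor (abs_tensor p) - p) = 0"
    unfolding tensor_rel_def by (rule lin_ext_tensor_null[OF assms])
  then show ?thesis
    by (simp add: tensor_lift_def clinear_diff[OF clinear_lin_ext])
qed

lemma tensor_lift_tensor: "cbilinear B \<Longrightarrow> tensor_lift B (a \<otimes> b) = B a b"
  by (simp add: tensor.abs_eq tensor_lift_abs free_tensor_def)

lemma clinear_tensor_lift:
  assumes "cbilinear B" shows "clinear (tensor_lift B)"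
proof (rule clinearI)
  show "tensor_lift B (x + y) = tensor_lift B x + tensor_lift B y" for x y
    by (induction x rule: tensor.abs_induct; induction y rule: tensor.abs_induct)
      (simp add: plus_tensor.abs_eq tensor_lift_abs[OF assms] clinear_add[OF clinear_lin_ext])
  show "tensor_lift B (c *\<^sub>C x) = c *\<^sub>C tensor_lift B x" for c x
    by (induction x rule: tensor.abs_induct)
      (simp add: scaleC_tensor.abs_eq tensor_lift_abs[OF assms] clinear_scaleC[OF clinear_lin_ext])
qed

lemma tensor_null_mult:
  fixes p :: "('a::complex_algebra_1, 'b::complex_algebra_1) simple_tensor \<Rightarrow>\<^sub>0 complex"
  assumes "p \<in> tensor_null"
  shows tensor_null_mult_left: "r * p \<in> tensor_null"
    and tensor_null_mult_right: "p * r \<in> tensor_null"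
proof -
  have m: "free_tensor a b * free_tensor c d = free_tensor (a * c) (b * d)"
    for a c :: 'a and b d :: 'b
    by (simp add: free_tensor_def mult_single)
  have s: "Poly_Mapping.single k c = c *\<^sub>C (case k of Simple a b \<Rightarrow> free_tensor a b)"
    for k :: "('a, 'b) simple_tensor" and c
    by (cases k) (simp add: free_tensor_def scaleC_single)
  have L: "free_tensor a b * p \<in> tensor_null" and R: "p * free_tensor a b \<in> tensor_null"
    for a :: 'a and b :: 'b
    using assms
    by (induction; simp add: m right_diff_distrib left_diff_distrib distrib_left distrib_right
        mult_scaleC_left mult_scaleC_right tensor_null.intros)+
  show "r * p \<in> tensor_null"
    by (induction r rule: free_induct)
      (auto simp: s mult_scaleC_left distrib_right intro!: tensor_null.add tensor_null.scaleC L
        split: simple_tensor.split)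
  show "p * r \<in> tensor_null"
    by (induction r rule: free_induct)
      (auto simp: s mult_scaleC_right distrib_left intro!: tensor_null.add tensor_null.scaleC R
        split: simple_tensor.split)
qed

lemma exists_functional:
  fixes x :: "'a::complex_vector"
  assumes "x \<noteq> 0"
  obtains \<phi> :: "'a \<Rightarrow> complex" where "clinear \<phi>" "\<phi> x = 1"
proof -
  interpret vector_space_pair "scaleC :: _ \<Rightarrow> 'a \<Rightarrow> 'a" "scaleC :: _ \<Rightarrow> complex \<Rightarrow> complex" ..
  have "complex_vector.independent {x}"
    using assms by (simp add: complex_vector.dependent_single)
  from linear_independent_extend[OF this, of "\<lambda>_. 1"]
  obtain g :: "'a \<Rightarrow> complex" where g: "Vector_Spaces.linear scaleC scaleC g" "g x = 1"
    by (auto simp del: scaleC_complex_def)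
  have "clinear g"
    by (rule clinearI) (use g in \<open>auto simp: Vector_Spaces.linear_iff\<close>)
  with g that show ?thesis by blast
qed

lemma tensor_neq_0:
  assumes "a \<noteq> 0" "b \<noteq> 0"
  shows "a \<otimes> b \<noteq> 0"
proof -
  obtain \<phi> :: "'a \<Rightarrow> complex" where \<phi>: "clinear \<phi>" "\<phi> a = 1"
    using exists_functional[OF assms(1)] .
  obtain \<psi> :: "'b \<Rightarrow> complex" where \<psi>: "clinear \<psi>" "\<psi> b = 1"
    using exists_functional[OF assms(2)] .
  have B: "cbilinear (\<lambda>a b. \<phi> a * \<psi> b)"
    using \<phi>(1) \<psi>(1) by (simp add: cbilinear_def clinear_def algebra_simps)
  then have "tensor_lift (\<lambda>a b. \<phi> a * \<psi> b) (a \<otimes> b) = 1"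
    by (simp add: tensor_lift_tensor \<phi> \<psi>)
  then show ?thesis
    using clinear_zero[OF clinear_tensor_lift[OF B]] by auto
qed

instantiation tensor :: (complex_algebra_1, complex_algebra_1) complex_algebra_1
begin

lift_definition one_tensor :: "('a, 'b) tensor" is 1 .
lift_definition times_tensor :: "('a, 'b) tensor \<Rightarrow> ('a, 'b) tensor \<Rightarrow> ('a, 'b) tensor" is "(*)"
proof -
  fix p p' q q' :: "('a, 'b) simple_tensor \<Rightarrow>\<^sub>0 complex"
  assume "tensor_rel p p'" "tensor_rel q q'"
  then have "p * (q - q') + (p - p') * q' \<in> tensor_null"
    unfolding tensor_rel_def by (intro tensor_null.add tensor_null_mult_left tensor_null_mult_right)
  then show "tensor_rel (p * q) (p' * q')"
    by (simp add: tensor_rel_def algebra_simps)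
qed

instance
proof
  have "(1 :: ('a, 'b) tensor) = 1 \<otimes> 1"
    by transfer (rule tensor_rel_refl, simp add: free_tensor_def zero_simple_tensor_def flip: single_one)
  then show "(0 :: ('a, 'b) tensor) \<noteq> 1"
    using tensor_neq_0[of "1 :: 'a" "1 :: 'b"] by simp
qed (transfer, rule tensor_rel_refl,
    simp add: algebra_simps scaleC_add_left scaleC_add_right scaleC_scaleC mult_scaleC_left
      mult_scaleC_right)+

end

lemma tensor_mult: "(a \<otimes> b) * (c \<otimes> d) = (a * c) \<otimes> (b * d)"
  by transfer (rule tensor_rel_refl, simp add: free_tensor_def mult_single)


unbundle no vec_syntax and fps_syntax

text \<open>The completion of an algebraic tensor product \<open>A[[\<lambda>]] \<otimes> B[[\<lambda>]]\<close> over \<open>\<complex>[[\<lambda>]]\<close> is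
  \<open>(A \<otimes> B)[[\<lambda>]]\<close>, the type \<^typ>\<open>('a, 'b) tensor fps\<close>.\<close>

instantiation fps :: (complex_vector) complex_vector
begin
definition scaleC_fps :: "complex \<Rightarrow> 'a fps \<Rightarrow> 'a fps" where
  "scaleC_fps c u = Abs_fps (\<lambda>n. c *\<^sub>C u $ n)"
instance
  by standard (simp_all add: scaleC_fps_def fps_eq_iff scaleC_add_left scaleC_add_right scaleC_scaleC)
end

definition fps_map :: "('a \<Rightarrow> 'b) \<Rightarrow> 'a fps \<Rightarrow> 'b fps" where
  "fps_map f u = Abs_fps (\<lambda>n. f (u $ n))"

text \<open>The \<open>\<complex>[[\<lambda>]]\<close>-bilinear extension of a bilinear map.\<close>

definition fps_bilinear :: "('a \<Rightarrow> 'b \<Rightarrow> 'c::comm_monoid_add) \<Rightarrow> 'a fps \<Rightarrow> 'b fps \<Rightarrow> 'c fps" where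
  "fps_bilinear B u v = Abs_fps (\<lambda>n. \<Sum>k=0..n. B (u $ k) (v $ (n - k)))"

abbreviation fps_smult :: "complex fps \<Rightarrow> 'a::complex_vector fps \<Rightarrow> 'a fps" (infixr \<open>*\<^sub>\<lambda>\<close> 73) where
  "fps_smult \<equiv> fps_bilinear scaleC"

abbreviation fps_tensor ::
  "'a::complex_vector fps \<Rightarrow> 'b::complex_vector fps \<Rightarrow> ('a, 'b) tensor fps" (infixr \<open>\<otimes>\<^sub>\<lambda>\<close> 72) where
  "fps_tensor \<equiv> fps_bilinear (\<otimes>)"

global_interpretation fps_module: module "fps_smult :: complex fps \<Rightarrow> 'a::complex_vector fps \<Rightarrow> 'a fps"
proof
  fix c d :: "complex fps" and u v :: "'a fps"
  show "c *\<^sub>\<lambda> (u + v) = c *\<^sub>\<lambda> u + c *\<^sub>\<lambda> v"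
    by (simp add: fps_bilinear_def fps_eq_iff scaleC_add_right sum.distrib)
  show "(c + d) *\<^sub>\<lambda> u = c *\<^sub>\<lambda> u + d *\<^sub>\<lambda> u"
    by (simp add: fps_bilinear_def fps_eq_iff scaleC_add_left sum.distrib)
  show "1 *\<^sub>\<lambda> u = u"
  proof (rule fps_ext)
    fix n
    have "(1 *\<^sub>\<lambda> u) $ n = (\<Sum>k=0..n. if k = 0 then u $ n else 0)"
      unfolding fps_bilinear_def fps_nth_Abs_fps by (rule sum.cong) auto
    then show "(1 *\<^sub>\<lambda> u) $ n = u $ n" by simp
  qed
  show "c *\<^sub>\<lambda> d *\<^sub>\<lambda> u = (c * d) *\<^sub>\<lambda> u"
  proof (rule fps_ext)
    fix n
    show "(c *\<^sub>\<lambda> d *\<^sub>\<lambda> u) $ n = ((c * d) *\<^sub>\<lambda> u) $ n"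
      using fps_mult_assoc_lemma[where k = n and n = n and f = "\<lambda>i j k. (c $ i * d $ j) *\<^sub>C u $ k"]
      by (simp add: fps_bilinear_def fps_mult_nth complex_vector.scale_sum_left
          complex_vector.scale_sum_right scaleC_scaleC)
  qed
qed

text \<open>For \<open>T = x\<^sup>\<alpha> \<otimes> x\<^sub>\<alpha>\<close> (sum over \<open>\<alpha>\<close>), \<open>contract B T\<close> is the \<open>\<lambda>\<close>-adically convergent sum
  \<open>B x\<^sup>\<alpha> x\<^sub>\<alpha>\<close>, for \<open>B\<close> bilinear over \<open>\<complex>\<close>.\<close>

definition contract ::
  "('a::complex_vector \<Rightarrow> 'b::complex_vector \<Rightarrow> 'w::complex_vector fps) \<Rightarrow> ('a, 'b) tensor fps \<Rightarrow> 'w fps"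
  where "contract B T = Abs_fps (\<lambda>n. \<Sum>k=0..n. tensor_lift B (T $ k) $ (n - k))"

text \<open>The closure is taken in the \<open>\<lambda>\<close>-adic topology.\<close>

definition completed_tensor ::
  "'a::complex_vector fps set \<Rightarrow> 'b::complex_vector fps set \<Rightarrow> ('a, 'b) tensor fps set" where
  "completed_tensor A B = closure (fps_module.span {x \<otimes>\<^sub>\<lambda> y | x y. x \<in> A \<and> y \<in> B})"

text \<open>\<open>exp_lambda x = exp (\<lambda> x)\<close>, where \<open>\<lambda>\<close> is the formal variable\<close>

definition exp_lambda :: "'a::complex_algebra_1 \<Rightarrow> 'a fps" where
  "exp_lambda x = Abs_fps (\<lambda>n. (1 / fact n) *\<^sub>C x ^ n)"

definition two_sided_inverse :: "'a::ring_1 \<Rightarrow> 'a" where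
  "two_sided_inverse x = (THE y. x * y = 1 \<and> y * x = 1)"

text \<open>A twist is an element \<open>\<F> = f\<^sup>\<alpha> \<otimes> f\<^sub>\<alpha>\<close> of the completed tensor square of the enveloping algebra;
  below, \<open>\<F>\<^sup>-\<^sup>1 = g\<^sup>\<alpha> \<otimes> g\<^sub>\<alpha>\<close> and \<open>\<R>\<^sup>-\<^sup>1 = r\<^sup>\<alpha> \<otimes> r\<^sub>\<alpha>\<close>.\<close>

type_synonym 'l twist = "('l uea, 'l uea) tensor fps"

definition tensor_flip :: "('a::complex_vector, 'b::complex_vector) tensor \<Rightarrow> ('b, 'a) tensor" where
  "tensor_flip = tensor_lift (\<lambda>a b. b \<otimes> a)"

definition R_matrix :: "'l::complex_lie_algebra twist \<Rightarrow> 'l twist" where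
  "R_matrix \<F> = fps_map tensor_flip \<F> * two_sided_inverse \<F>"

text \<open>\<open>[u, v]\<^sub>\<star> = [g\<^sup>\<alpha>(u), g\<^sub>\<alpha>(v)]\<close>\<close>

definition star_bracket :: "'l::complex_lie_algebra twist \<Rightarrow> 'l fps \<Rightarrow> 'l fps \<Rightarrow> 'l fps" where
  "star_bracket \<F> u v =
    contract (\<lambda>\<xi> \<eta>. fps_bilinear bracket (fps_map (uea_act \<xi>) u) (fps_map (uea_act \<eta>) v))
      (two_sided_inverse \<F>)"

text \<open>\<open>\<chi> = f\<^sup>\<alpha> S(f\<^sub>\<alpha>)\<close>\<close>

definition twist_chi :: "'l::complex_lie_algebra twist \<Rightarrow> 'l uea fps" where
  "twist_chi \<F> = contract (\<lambda>\<xi> \<eta>. fps_const (\<xi> * antipode \<eta>)) \<F>"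

text \<open>\<open>X\<^sub>\<xi> = g\<^sup>\<alpha> \<xi> \<chi> S\<^sup>-\<^sup>1(g\<^sub>\<alpha>)\<close>\<close>

definition twist_X :: "'l::complex_lie_algebra twist \<Rightarrow> 'l uea \<Rightarrow> 'l uea fps" where
  "twist_X \<F> \<xi> =
    contract (\<lambda>\<eta> \<zeta>. fps_const \<eta> * fps_const \<xi> * twist_chi \<F> * fps_const (inv antipode \<zeta>))
      (two_sided_inverse \<F>)"

text \<open>\<open>\<Delta>\<^sub>\<star>(u) = u \<otimes> 1 + X\<^bsub>r\<^sup>\<alpha>\<^esub> \<otimes> r\<^sub>\<alpha>(u)\<close>\<close>

definition star_coproduct :: "'l::complex_lie_algebra twist \<Rightarrow> 'l fps \<Rightarrow> 'l twist" where
  "star_coproduct \<F> u =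
    fps_map uea_inj u \<otimes>\<^sub>\<lambda> 1 +
    contract (\<lambda>\<xi> \<eta>. twist_X \<F> \<xi> \<otimes>\<^sub>\<lambda> fps_map uea_inj (fps_map (uea_act \<eta>) u))
      (two_sided_inverse (R_matrix \<F>))"

text \<open>\<open>\<F> = exp (- (\<i> \<lambda> / 2) \<theta>\<^sup>a\<^sup>b V\<^sub>a \<otimes> V\<^sub>b)\<close>, with indices \<open>a, b < r\<close>\<close>

definition abelian_twist ::
  "nat \<Rightarrow> (nat \<Rightarrow> nat \<Rightarrow> complex) \<Rightarrow> (nat \<Rightarrow> 'l::complex_lie_algebra) \<Rightarrow> 'l twist" where
  "abelian_twist r \<theta> V =
    exp_lambda ((- \<i> / 2) *\<^sub>C (\<Sum>a<r. \<Sum>b<r. \<theta> a b *\<^sub>C (uea_inj (V a) \<otimes> uea_inj (V b))))"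

definition lie_subalgebra :: "'l::complex_lie_algebra set \<Rightarrow> bool" where
  "lie_subalgebra \<gg> \<longleftrightarrow>
    complex_vector.subspace \<gg> \<and> (\<forall>x\<in>\<gg>. \<forall>y\<in>\<gg>. bracket x y \<in> \<gg>)"

definition is_basis :: "nat \<Rightarrow> (nat \<Rightarrow> 'l::complex_vector) \<Rightarrow> 'l set \<Rightarrow> bool" where
  "is_basis d t \<gg> \<longleftrightarrow>
    inj_on t {..<d} \<and> complex_vector.independent (t ` {..<d}) \<and> complex_vector.span (t ` {..<d}) = \<gg>"

definition lambda_span :: "nat \<Rightarrow> (nat \<Rightarrow> 'l::complex_vector fps) \<Rightarrow> 'l fps set" where
  "lambda_span d t' = fps_module.span (t' ` {..<d})"

text \<open>The span of \<open>t'\<^sub>0, \<dots>, t'\<^sub>d\<^sub>-\<^sub>1\<close> is a \<open>\<star>\<close>-Lie subalgebra that deforms the Lie algebra with basis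
  \<open>t\<^sub>0, \<dots>, t\<^sub>d\<^sub>-\<^sub>1\<close> and structure constants \<open>f i j k\<close>.\<close>

definition star_lie_subalgebra ::
  "'l::complex_lie_algebra twist \<Rightarrow> nat \<Rightarrow> (nat \<Rightarrow> 'l) \<Rightarrow> (nat \<Rightarrow> nat \<Rightarrow> nat \<Rightarrow> complex) \<Rightarrow>
    (nat \<Rightarrow> 'l fps) \<Rightarrow> bool" where
  "star_lie_subalgebra \<F> d t f t' \<longleftrightarrow>
    (\<forall>i<d. t' i $ 0 = t i) \<and>
    (\<forall>u\<in>lambda_span d t'. \<forall>v\<in>lambda_span d t'. star_bracket \<F> u v \<in> lambda_span d t') \<and>
    (\<exists>f'. \<forall>i<d. \<forall>j<d.
      star_bracket \<F> (t' i) (t' j) = (\<Sum>k<d. f' i j k *\<^sub>\<lambda> t' k) \<and> (\<forall>k<d. f' i j k $ 0 = f i j k)) \<and>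
    (\<forall>u\<in>lambda_span d t'. \<exists>v\<in>lambda_span d t'.
      \<exists>w\<in>completed_tensor UNIV (fps_map uea_inj ` lambda_span d t').
        star_coproduct \<F> u = fps_map uea_inj v \<otimes>\<^sub>\<lambda> 1 + w)"

text \<open>For a multi-index \<open>as = [a\<^sub>1, \<dots>, a\<^sub>n]\<close>, the entry \<open>(i, j)\<close> of \<open>N\<^bsub>a\<^sub>n\<^esub> \<cdots> N\<^bsub>a\<^sub>1\<^esub>\<close>.\<close>

fun multi_const :: "nat \<Rightarrow> (nat \<Rightarrow> nat \<Rightarrow> nat \<Rightarrow> complex) \<Rightarrow> nat list \<Rightarrow> nat \<Rightarrow> nat \<Rightarrow> complex" where
  "multi_const d N [] i j = (if i = j then 1 else 0)"
| "multi_const d N (a # as) i j = (\<Sum>k<d. multi_const d N as i k * N a k j)"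

definition multi_theta :: "(nat \<Rightarrow> nat \<Rightarrow> complex) \<Rightarrow> nat list \<Rightarrow> nat list \<Rightarrow> complex fps" where
  "multi_theta \<theta> bs as =
    fps_const (1 / fact (length as)) * (fps_const (\<i> / 2) * fps_X) ^ length as *
    fps_const (\<Prod>k<length as. \<theta> (bs ! k) (as ! k))"

definition multi_indices :: "nat \<Rightarrow> nat \<Rightarrow> nat list set" where
  "multi_indices r n = {as. length as = n \<and> set as \<subseteq> {..<r}}"

definition star_const_term ::
  "nat \<Rightarrow> (nat \<Rightarrow> nat \<Rightarrow> complex) \<Rightarrow> nat \<Rightarrow> (nat \<Rightarrow> nat \<Rightarrow> nat \<Rightarrow> complex) \<Rightarrow>
    (nat \<Rightarrow> nat \<Rightarrow> nat \<Rightarrow> complex) \<Rightarrow> nat \<Rightarrow> nat \<Rightarrow> nat \<Rightarrow> nat \<Rightarrow> complex fps" where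
  "star_const_term r \<theta> d N f i j m n =
    (\<Sum>bs\<in>multi_indices r n. \<Sum>as\<in>multi_indices r n. \<Sum>k<d. \<Sum>l<d.
      multi_theta \<theta> bs as *
      fps_const (multi_const d N bs i k * multi_const d N as j l * f k l m))"

text \<open>\<open>\<real>\<^sup>n\<close> is the set of \<open>x :: nat \<Rightarrow> real\<close> with \<open>x i = 0\<close> for \<open>i \<ge> n\<close>, as in \<^const>\<open>Euclidean_space\<close>.\<close>

definition partial_deriv :: "nat \<Rightarrow> ((nat \<Rightarrow> real) \<Rightarrow> 'b::real_normed_vector) \<Rightarrow> (nat \<Rightarrow> real) \<Rightarrow> 'b" where
  "partial_deriv i f x = vector_derivative (\<lambda>s. f (x(i := s))) (at (x i))"

primrec k_smooth_on ::
  "nat \<Rightarrow> nat \<Rightarrow> (nat \<Rightarrow> real) set \<Rightarrow> ((nat \<Rightarrow> real) \<Rightarrow> 'b::real_normed_vector) \<Rightarrow> bool" where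
  "k_smooth_on 0 n W f \<longleftrightarrow> continuous_on W f"
| "k_smooth_on (Suc k) n W f \<longleftrightarrow> continuous_on W f \<and>
    (\<forall>i<n. (\<forall>x\<in>W. (\<lambda>s. f (x(i := s))) differentiable (at (x i))) \<and>
      k_smooth_on k n W (partial_deriv i f))"

definition smooth_on ::
  "nat \<Rightarrow> (nat \<Rightarrow> real) set \<Rightarrow> ((nat \<Rightarrow> real) \<Rightarrow> 'b::real_normed_vector) \<Rightarrow> bool" where
  "smooth_on n W f \<longleftrightarrow> (\<forall>k. k_smooth_on k n W f)"

lemma openin_line:
  assumes "openin (Euclidean_space n) W" "x \<in> W" "i < n"
  shows "\<forall>\<^sub>F s in at (x i). x(i := s) \<in> W"
proof -
  obtain T where T: "open T" "W = T \<inter> {x. \<forall>i\<ge>n. x i = 0}"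
    using assms(1) unfolding Euclidean_space_def openin_subtopology
    by (auto simp: euclidean_product_topology open_openin[symmetric])
  have "continuous_on UNIV (\<lambda>s. x(i := s))"
  proof (rule continuous_on_coordinatewise_then_product)
    show "continuous_on UNIV (\<lambda>s. (x(i := s)) j)" for j
      by (cases "j = i") simp_all
  qed
  then have "open ((\<lambda>s. x(i := s)) -` T)"
    using T(1) by (rule open_vimage[rotated])
  moreover have "x i \<in> (\<lambda>s. x(i := s)) -` T"
    using assms(2) T by simp
  ultimately have "\<forall>\<^sub>F s in at (x i). s \<in> (\<lambda>s. x(i := s)) -` T"
    by (rule topological_tendstoD[OF tendsto_ident_at])
  then show ?thesis
    by eventually_elim (use assms(2,3) T(2) in auto)
qed

lemma k_smooth_on_cong:
  assumes "openin (Euclidean_space n) W" "\<And>x. x \<in> W \<Longrightarrow> f x = g x" "k_smooth_on k n W f"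
  shows "k_smooth_on k n W g"
  using assms(2,3)
proof (induction k arbitrary: f g)
  case 0
  then show ?case using continuous_on_cong[of W W f g] by simp
next
  case (Suc k)
  have ev: "\<forall>\<^sub>F s in at (x i). f (x(i := s)) = g (x(i := s))" if "x \<in> W" "i < n" for x i
    using openin_line[OF assms(1) that] by eventually_elim (rule Suc.prems(1))
  have d: "((\<lambda>s. g (x(i := s))) has_vector_derivative D) (at (x i))"
    if "((\<lambda>s. f (x(i := s))) has_vector_derivative D) (at (x i))" "x \<in> W" "i < n" for x i D
    using that(1) unfolding has_vector_derivative_def
    by (rule has_derivative_transform_eventually[OF _ ev[OF that(2,3)]])
      (use Suc.prems(1) that in auto)
  show ?case
    unfolding k_smooth_on.simps
  proof (intro conjI allI impI ballI)
    show "continuous_on W g"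
      using Suc.prems continuous_on_cong[of W W f g] by simp
    fix i assume i: "i < n"
    have D: "((\<lambda>s. f (x(i := s))) has_vector_derivative partial_deriv i f x) (at (x i))" if "x \<in> W" for x
      using Suc.prems(2) i that by (simp add: partial_deriv_def vector_derivative_works)
    show "(\<lambda>s. g (x(i := s))) differentiable (at (x i))" if "x \<in> W" for x
      using d[OF D[OF that] that i] by (rule differentiableI_vector)
    show "k_smooth_on k n W (partial_deriv i g)"
    proof (rule Suc.IH)
      show "k_smooth_on k n W (partial_deriv i f)" using Suc.prems(2) i by simp
      show "partial_deriv i f x = partial_deriv i g x" if "x \<in> W" for x
        using d[OF D[OF that] that i] by (simp add: partial_deriv_def[of i g] vector_derivative_at)
    qed
  qed
qed

lemma k_smooth_on_SucI:
  assumes "openin (Euclidean_space n) W" "continuous_on W f"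
    and "\<And>i x. i < n \<Longrightarrow> x \<in> W \<Longrightarrow> ((\<lambda>s. f (x(i := s))) has_vector_derivative D i x) (at (x i))"
    and "\<And>i. i < n \<Longrightarrow> k_smooth_on k n W (D i)"
  shows "k_smooth_on (Suc k) n W f"
  unfolding k_smooth_on.simps
proof (intro conjI allI impI ballI)
  fix i assume i: "i < n"
  show "(\<lambda>s. f (x(i := s))) differentiable (at (x i))" if "x \<in> W" for x
    using assms(3)[OF i that] by (rule differentiableI_vector)
  show "k_smooth_on k n W (partial_deriv i f)"
    by (rule k_smooth_on_cong[OF assms(1) _ assms(4)[OF i]])
      (simp add: partial_deriv_def vector_derivative_at[OF assms(3)[OF i]])
qed (rule assms)

lemma k_smooth_on_SucD:
  assumes "k_smooth_on (Suc k) n W f" "i < n"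
  shows "x \<in> W \<Longrightarrow> ((\<lambda>s. f (x(i := s))) has_vector_derivative partial_deriv i f x) (at (x i))"
    and "k_smooth_on k n W (partial_deriv i f)"
  using assms by (auto simp: partial_deriv_def vector_derivative_works)

lemma k_smooth_on_continuous: "k_smooth_on k n W f \<Longrightarrow> continuous_on W f"
  by (cases k) auto

lemma k_smooth_on_Suc_imp: "k_smooth_on (Suc k) n W f \<Longrightarrow> k_smooth_on k n W f"
  by (induction k arbitrary: f) auto

lemma k_smooth_on_const:
  assumes "openin (Euclidean_space n) W"
  shows "k_smooth_on k n W (\<lambda>_. c)"
proof (induction k arbitrary: c)
  case (Suc k)
  show ?case by (rule k_smooth_on_SucI[OF assms _ has_vector_derivative_const Suc]) simp
qed simp

lemma k_smooth_on_add:
  assumes "openin (Euclidean_space n) W" "k_smooth_on k n W f" "k_smooth_on k n W g"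
  shows "k_smooth_on k n W (\<lambda>x. f x + g x)"
  using assms(2,3)
proof (induction k arbitrary: f g)
  case (Suc k)
  show ?case
  proof (rule k_smooth_on_SucI[OF assms(1)])
    show "continuous_on W (\<lambda>x. f x + g x)"
      using Suc.prems by (intro continuous_on_add k_smooth_on_continuous)
    fix i assume i: "i < n"
    show "((\<lambda>s. f (x(i := s)) + g (x(i := s))) has_vector_derivative
        partial_deriv i f x + partial_deriv i g x) (at (x i))" if "x \<in> W" for x
      using Suc.prems i that by (intro has_vector_derivative_add k_smooth_on_SucD(1))
    show "k_smooth_on k n W (\<lambda>x. partial_deriv i f x + partial_deriv i g x)"
      using Suc.prems i by (intro Suc.IH k_smooth_on_SucD(2))
  qed
qed (auto intro: continuous_on_add)

lemma k_smooth_on_mult: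
  fixes f g :: "(nat \<Rightarrow> real) \<Rightarrow> 'b::real_normed_algebra"
  assumes "openin (Euclidean_space n) W" "k_smooth_on k n W f" "k_smooth_on k n W g"
  shows "k_smooth_on k n W (\<lambda>x. f x * g x)"
  using assms(2,3)
proof (induction k arbitrary: f g)
  case (Suc k)
  show ?case
  proof (rule k_smooth_on_SucI[OF assms(1)])
    fix i assume i: "i < n"
    show "((\<lambda>s. f (x(i := s)) * g (x(i := s))) has_vector_derivative
        f x * partial_deriv i g x + partial_deriv i f x * g x) (at (x i))" if "x \<in> W" for x
      using has_vector_derivative_mult[OF k_smooth_on_SucD(1)[OF Suc.prems(1) i that]
          k_smooth_on_SucD(1)[OF Suc.prems(2) i that]] by (simp only: fun_upd_triv)
    show "k_smooth_on k n W (\<lambda>x. f x * partial_deriv i g x + partial_deriv i f x * g x)"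
    proof (rule k_smooth_on_add[OF assms(1)])
      show "k_smooth_on k n W (\<lambda>x. f x * partial_deriv i g x)"
        by (rule Suc.IH[OF k_smooth_on_Suc_imp[OF Suc.prems(1)] k_smooth_on_SucD(2)[OF Suc.prems(2) i]])
      show "k_smooth_on k n W (\<lambda>x. partial_deriv i f x * g x)"
        by (rule Suc.IH[OF k_smooth_on_SucD(2)[OF Suc.prems(1) i] k_smooth_on_Suc_imp[OF Suc.prems(2)]])
    qed
  qed (use Suc.prems in \<open>auto intro: continuous_on_mult\<close>)
qed (auto intro: continuous_on_mult)

class smooth_manifold = t2_space + second_countable_topology +
  fixes manifold_dim :: "'a itself \<Rightarrow> nat"
    and atlas :: "('a set \<times> ('a \<Rightarrow> nat \<Rightarrow> real)) set"
  assumes atlas_cover: "(\<Union>(U, \<phi>)\<in>atlas. U) = UNIV"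
    and atlas_chart: "(U, \<phi>) \<in> atlas \<Longrightarrow>
      open U \<and> openin (Euclidean_space (manifold_dim TYPE('a))) (\<phi> ` U) \<and>
      homeomorphic_map (subtopology (topology open) U) (subtopology (Euclidean_space (manifold_dim TYPE('a))) (\<phi> ` U)) \<phi>"
    and atlas_compatible: "(U, \<phi>) \<in> atlas \<Longrightarrow> (V, \<psi>) \<in> atlas \<Longrightarrow> i < manifold_dim TYPE('a) \<Longrightarrow>
      smooth_on (manifold_dim TYPE('a)) (\<phi> ` (U \<inter> V)) (\<lambda>x. \<psi> (inv_into U \<phi> x) i)"

definition smooth_map :: "('m::smooth_manifold \<Rightarrow> complex) \<Rightarrow> bool" where
  "smooth_map f \<longleftrightarrow> (\<forall>(U, \<phi>)\<in>atlas. smooth_on (manifold_dim TYPE('m)) (\<phi> ` U) (f \<circ> inv_into U \<phi>))"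

lemma smooth_map_const: "smooth_map (\<lambda>_. c)"
  unfolding smooth_map_def smooth_on_def o_def
  using atlas_chart k_smooth_on_const by blast

lemma smooth_map_add: "smooth_map f \<Longrightarrow> smooth_map g \<Longrightarrow> smooth_map (\<lambda>x. f x + g x)"
  unfolding smooth_map_def smooth_on_def o_def
  by (fast intro: k_smooth_on_add dest: atlas_chart)

lemma smooth_map_mult: "smooth_map f \<Longrightarrow> smooth_map g \<Longrightarrow> smooth_map (\<lambda>x. f x * g x)"
  unfolding smooth_map_def smooth_on_def o_def
  by (fast intro: k_smooth_on_mult dest: atlas_chart)

typedef (overloaded) 'm smooth_function = "{f :: 'm::smooth_manifold \<Rightarrow> complex. smooth_map f}"
  using smooth_map_const by blast

setup_lifting type_definition_smooth_function

instantiation smooth_function :: (smooth_manifold) "{comm_ring_1, complex_algebra_1}"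
begin

lift_definition zero_smooth_function :: "'a smooth_function" is "\<lambda>_. 0" by (rule smooth_map_const)
lift_definition one_smooth_function :: "'a smooth_function" is "\<lambda>_. 1" by (rule smooth_map_const)
lift_definition plus_smooth_function :: "'a smooth_function \<Rightarrow> 'a smooth_function \<Rightarrow> 'a smooth_function"
  is "\<lambda>f g x. f x + g x" by (rule smooth_map_add)
lift_definition times_smooth_function :: "'a smooth_function \<Rightarrow> 'a smooth_function \<Rightarrow> 'a smooth_function"
  is "\<lambda>f g x. f x * g x" by (rule smooth_map_mult)
lift_definition uminus_smooth_function :: "'a smooth_function \<Rightarrow> 'a smooth_function"
  is "\<lambda>f x. - f x" using smooth_map_mult[OF smooth_map_const[of "- 1"]] by simp
lift_definition minus_smooth_function :: "'a smooth_function \<Rightarrow> 'a smooth_function \<Rightarrow> 'a smooth_function"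
  is "\<lambda>f g x. f x - g x"
  using smooth_map_add[OF _ smooth_map_mult[OF smooth_map_const[of "- 1"]]] by simp
lift_definition scaleC_smooth_function :: "complex \<Rightarrow> 'a smooth_function \<Rightarrow> 'a smooth_function"
  is "\<lambda>c f x. c * f x" by (rule smooth_map_mult[OF smooth_map_const])

instance by standard (transfer; simp add: fun_eq_iff algebra_simps)+

end

definition derivation :: "('a::complex_algebra_1 \<Rightarrow> 'a) \<Rightarrow> bool" where
  "derivation D \<longleftrightarrow> clinear D \<and> (\<forall>f g. D (f * g) = D f * g + f * D g)"

lemma derivationI:
  assumes "\<And>f g. D (f + g) = D f + D g" "\<And>c f. D (c *\<^sub>C f) = c *\<^sub>C D f"
    "\<And>f g. D (f * g) = D f * g + f * D g"
  shows "derivation D"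
  using assms by (simp add: derivation_def clinear_def)

lemma derivationD:
  assumes "derivation D"
  shows "D (f + g) = D f + D g" "D (c *\<^sub>C f) = c *\<^sub>C D f" "D (f * g) = D f * g + f * D g"
    "D (f - g) = D f - D g"
  using assms clinear_diff[of D] by (simp_all add: derivation_def clinear_def)

lemma derivation_scaleC:
  assumes "derivation D" shows "derivation (\<lambda>f. c *\<^sub>C D f)"
  by (rule derivationI)
    (simp_all add: derivationD[OF assms] scaleC_add_right scaleC_scaleC mult_scaleC_left
      mult_scaleC_right mult.commute[where 'a = complex])

lemma derivation_add:
  assumes "derivation D" "derivation E" shows "derivation (\<lambda>f. D f + E f)"
  by (rule derivationI)
    (simp_all add: derivationD[OF assms(1)] derivationD[OF assms(2)] scaleC_add_right
      distrib_left distrib_right)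

lemma derivation_uminus: "derivation D \<Longrightarrow> derivation (\<lambda>f. - D f)"
  using derivation_scaleC[of D "-1"] by simp

lemma derivation_diff: "derivation D \<Longrightarrow> derivation E \<Longrightarrow> derivation (\<lambda>f. D f - E f)"
  using derivation_add[OF _ derivation_uminus, of D E] by simp

lemma derivation_commutator:
  assumes "derivation D" "derivation E" shows "derivation (\<lambda>f. D (E f) - E (D f))"
  by (rule derivationI)
    (simp_all add: derivationD[OF assms(1)] derivationD[OF assms(2)] left_diff_distrib
      right_diff_distrib complex_vector.scale_right_diff_distrib)

text \<open>Vector fields are complexified: they are derivations of the complex-valued smooth functions.\<close>

typedef (overloaded) 'm vector_field =
  "{D :: 'm::smooth_manifold smooth_function \<Rightarrow> 'm smooth_function. derivation D}"
  by (rule exI[of _ "\<lambda>_. 0"]) (simp add: derivation_def clinear_def)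

setup_lifting type_definition_vector_field

instantiation vector_field :: (smooth_manifold) complex_lie_algebra
begin

lift_definition zero_vector_field :: "'a vector_field" is "\<lambda>_. 0"
  by (simp add: derivation_def clinear_def)
lift_definition plus_vector_field :: "'a vector_field \<Rightarrow> 'a vector_field \<Rightarrow> 'a vector_field"
  is "\<lambda>D E f. D f + E f" by (rule derivation_add)
lift_definition minus_vector_field :: "'a vector_field \<Rightarrow> 'a vector_field \<Rightarrow> 'a vector_field"
  is "\<lambda>D E f. D f - E f" by (rule derivation_diff)
lift_definition uminus_vector_field :: "'a vector_field \<Rightarrow> 'a vector_field"
  is "\<lambda>D f. - D f" by (rule derivation_uminus)
lift_definition scaleC_vector_field :: "complex \<Rightarrow> 'a vector_field \<Rightarrow> 'a vector_field"
  is "\<lambda>c D f. c *\<^sub>C D f" by (rule derivation_scaleC)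
lift_definition bracket_vector_field :: "'a vector_field \<Rightarrow> 'a vector_field \<Rightarrow> 'a vector_field"
  is "\<lambda>D E f. D (E f) - E (D f)" by (rule derivation_commutator)

instance
  by standard
    (transfer; simp add: fun_eq_iff derivationD scaleC_add_left scaleC_add_right
      scaleC_scaleC complex_vector.scale_right_diff_distrib)+

end

end

theory Submission
  imports Defs
begin

text \<open>
  Put \<open>x = \<theta>\<^sup>a\<^sup>b V\<^sub>a \<otimes> V\<^sub>b\<close>. Then \<open>\<F>\<^sup>-\<^sup>1 = exp (i \<lambda> x / 2)\<close>, and since antisymmetry of \<open>\<theta>\<close> makes the flip of
  \<open>x\<close> equal to \<open>- x\<close>, also \<open>\<R>\<^sup>-\<^sup>1 = exp (- i \<lambda> x)\<close>. The powers of \<open>x\<close> are linear combinations of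
  \<open>V\<^bsub>b\<^sub>1\<^esub> \<cdots> V\<^bsub>b\<^sub>n\<^esub> \<otimes> V\<^bsub>a\<^sub>1\<^esub> \<cdots> V\<^bsub>a\<^sub>n\<^esub>\<close>, and these monomials act by iterated brackets, under which \<open>\<gg>\<close> is
  stable. Hence every \<open>\<lambda>\<close>-coefficient of \<open>[u, v]\<^sub>\<star>\<close> and of the second legs of \<open>\<Delta>\<^sub>\<star>(u)\<close> stays in \<open>\<gg>\<close>.
\<close>

section \<open>Bilinear maps and their extension to power series\<close>

lemma cbilinearD:
  assumes "cbilinear B"
  shows "B (x + x') y = B x y + B x' y" "B x (y + y') = B x y + B x y'"
    "B (c *\<^sub>C x) y = c *\<^sub>C B x y" "B x (c *\<^sub>C y) = c *\<^sub>C B x y" "B 0 y = 0" "B x 0 = 0"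
    "B (\<Sum>i\<in>I. f i) y = (\<Sum>i\<in>I. B (f i) y)" "B x (\<Sum>i\<in>I. g i) = (\<Sum>i\<in>I. B x (g i))"
proof -
  have l: "clinear (B x)" "clinear (\<lambda>x. B x y)" for x y
    using assms by (auto simp: cbilinear_def)
  show "B (x + x') y = B x y + B x' y" "B x (y + y') = B x y + B x y'"
    "B (c *\<^sub>C x) y = c *\<^sub>C B x y" "B x (c *\<^sub>C y) = c *\<^sub>C B x y" and 0: "B 0 y = 0" "B x 0 = 0"
    using clinear_add[OF l(1)] clinear_add[OF l(2)] clinear_scaleC[OF l(1)] clinear_scaleC[OF l(2)]
      clinear_zero[OF l(1)] clinear_zero[OF l(2)] by auto
  show "B (\<Sum>i\<in>I. f i) y = (\<Sum>i\<in>I. B (f i) y)"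
    by (induction I rule: infinite_finite_induct)
      (simp_all add: clinear_add[OF l(2)] clinear_zero[OF l(2)])
  show "B x (\<Sum>i\<in>I. g i) = (\<Sum>i\<in>I. B x (g i))"
    by (induction I rule: infinite_finite_induct)
      (simp_all add: clinear_add[OF l(1)] clinear_zero[OF l(1)])
qed

lemma clinear_sum: "clinear f \<Longrightarrow> f (\<Sum>i\<in>I. g i) = (\<Sum>i\<in>I. f (g i))"
  by (induction I rule: infinite_finite_induct) (simp_all add: clinear_add clinear_zero)

lemma cbilinear_sum_sum:
  assumes "cbilinear B"
  shows "B (\<Sum>i\<in>I. c i *\<^sub>C x i) (\<Sum>j\<in>J. e j *\<^sub>C y j) =
    (\<Sum>i\<in>I. \<Sum>j\<in>J. (c i * e j) *\<^sub>C B (x i) (y j))"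
proof -
  have "B (\<Sum>i\<in>I. c i *\<^sub>C x i) (\<Sum>j\<in>J. e j *\<^sub>C y j) =
      (\<Sum>i\<in>I. B (c i *\<^sub>C x i) (\<Sum>j\<in>J. e j *\<^sub>C y j))"
    by (rule cbilinearD(7)[OF assms])
  also have "\<dots> = (\<Sum>i\<in>I. \<Sum>j\<in>J. (c i * e j) *\<^sub>C B (x i) (y j))"
    by (rule sum.cong[OF refl])
      (simp add: cbilinearD[OF assms] complex_vector.scale_sum_right scaleC_scaleC
        mult.commute[of "e _"])
  finally show ?thesis .
qed

lemma cbilinear_bracket: "cbilinear (bracket :: 'l::complex_lie_algebra \<Rightarrow> _)"
  by (simp add: cbilinear_def clinear_def bracket_add_left bracket_add_right bracket_scaleC_left
      bracket_scaleC_right)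

lemma fps_scaleC_nth [simp]: "(c *\<^sub>C u) $ n = c *\<^sub>C (u $ n)"
  by (simp add: scaleC_fps_def)

lemma fps_map_nth [simp]: "fps_map g u $ n = g (u $ n)"
  by (simp add: fps_map_def)

lemma fps_bilinear_nth: "fps_bilinear B u v $ n = (\<Sum>k=0..n. B (u $ k) (v $ (n - k)))"
  by (simp add: fps_bilinear_def)

lemma fps_bilinear_const:
  assumes "cbilinear B"
  shows "fps_bilinear B (fps_const x) (fps_const y) = fps_const (B x y)"
proof (rule fps_ext)
  fix n
  have "fps_bilinear B (fps_const x) (fps_const y) $ n =
      (\<Sum>k=0..n. if k = 0 then fps_const (B x y) $ n else 0)"
    unfolding fps_bilinear_nth by (rule sum.cong) (auto simp: cbilinearD[OF assms])
  then show "fps_bilinear B (fps_const x) (fps_const y) $ n = fps_const (B x y) $ n" by simp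
qed

lemma fps_smult_const_right_nth: "(c *\<^sub>\<lambda> fps_const x) $ n = c $ n *\<^sub>C x"
proof -
  have "(c *\<^sub>\<lambda> fps_const x) $ n = (\<Sum>k=0..n. if k = n then c $ n *\<^sub>C x else 0)"
    unfolding fps_bilinear_nth by (rule sum.cong) auto
  then show ?thesis by simp
qed

lemma fps_const_smult: "fps_const c *\<^sub>\<lambda> u = c *\<^sub>C u"
proof (rule fps_ext)
  fix n
  have "(fps_const c *\<^sub>\<lambda> u) $ n = (\<Sum>k=0..n. if k = 0 then c *\<^sub>C (u $ n) else 0)"
    unfolding fps_bilinear_nth by (rule sum.cong) auto
  then show "(fps_const c *\<^sub>\<lambda> u) $ n = (c *\<^sub>C u) $ n" by simp
qed

lemma fps_X_power_smult_nth: "(fps_X ^ k *\<^sub>\<lambda> u) $ n = (if n < k then 0 else u $ (n - k))"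
proof -
  have "(fps_X ^ k *\<^sub>\<lambda> u) $ n = (\<Sum>m=0..n. if m = k then u $ (n - k) else 0)"
    unfolding fps_bilinear_nth by (rule sum.cong) auto
  then show ?thesis by simp
qed

text \<open>Bilinearity over the complex numbers is all that \<open>tensor_lift\<close> asks of a
  map; the powers of \<lambda> are tracked separately by \<open>contract\<close>. This lemma feeds
  both the bracket and the tensor product of series into \<open>contract\<close>.\<close>

lemma cbilinear_fps_bilinear:
  assumes "cbilinear B"
  shows "cbilinear (fps_bilinear B)"
  by (auto simp: cbilinear_def clinear_def fps_eq_iff fps_bilinear_nth cbilinearD[OF assms] sum.distrib
      complex_vector.scale_sum_right)

lemma cbilinear_compose:
  assumes "cbilinear B" "clinear f" "clinear g"
  shows "cbilinear (\<lambda>x y. B (f x) (g y))"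
  using assms by (simp add: cbilinear_def clinear_def)

lemma clinear_fps_map:
  assumes "clinear f" shows "clinear (fps_map f)"
  by (rule clinearI) (simp_all add: fps_eq_iff clinear_add[OF assms] clinear_scaleC[OF assms])

lemma clinear_compose: "clinear f \<Longrightarrow> clinear g \<Longrightarrow> clinear (\<lambda>x. f (g x))"
  by (simp add: clinear_def)

section \<open>The adjoint action of monomials\<close>

lemma clinear_uea_act: "clinear (\<lambda>\<xi>. uea_act \<xi> v)"
proof (rule clinearI)
  show "uea_act (x + y) v = uea_act x v + uea_act y v" for x y
    by (transfer fixing: v) (rule clinear_add[OF clinear_free_act_left])
  show "uea_act (c *\<^sub>C x) v = c *\<^sub>C uea_act x v" for c x
    by (transfer fixing: v) (rule clinear_scaleC[OF clinear_free_act_left])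
qed

lemma clinear_fps_map_uea_act: "clinear (\<lambda>\<xi>. fps_map (uea_act \<xi>) u)"
  by (rule clinearI)
    (simp_all add: fps_eq_iff clinear_add[OF clinear_uea_act] clinear_scaleC[OF clinear_uea_act])

text \<open>Multiplicativity of the action turns a product into a composition. This is the passage
  from the enveloping algebra to iterated brackets, where stability of \<gg> can be used.\<close>

lemma uea_act_prod_list:
  "uea_act (prod_list (map (\<lambda>a. uea_inj (V a)) as)) v = foldr (\<lambda>a. bracket (V a)) as v"
  by (induction as) (simp_all add: uea_act_one uea_act_mult uea_act_inj)

section \<open>Formal exponentials and their inverses\<close>

lemma scaleC_power: "(c *\<^sub>C x) ^ n = c ^ n *\<^sub>C x ^ n" for x :: "'a::complex_algebra_1"
  by (induction n) (simp_all add: mult_scaleC_left mult_scaleC_right scaleC_scaleC mult.commute)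

text \<open>Both exponents are multiples of the same \<open>x\<close>, so each summand in degree n
  is a scalar times \<open>x ^ n\<close>, and the scalars add up by the binomial theorem.\<close>

lemma exp_lambda_mult:
  fixes x :: "'a::complex_algebra_1"
  shows "exp_lambda (a *\<^sub>C x) * exp_lambda (b *\<^sub>C x) = exp_lambda ((a + b) *\<^sub>C x)"
proof (rule fps_ext)
  fix n
  have "(\<Sum>k=0..n. 1 / fact k * (1 / fact (n - k)) * (a ^ k * b ^ (n - k))) =
      1 / fact n * (\<Sum>k=0..n. of_nat (n choose k) * a ^ k * b ^ (n - k))"
    unfolding sum_distrib_left by (rule sum.cong) (simp_all add: binomial_fact field_simps)
  also have "\<dots> = 1 / fact n * (a + b) ^ n"
    by (simp add: binomial_ring atLeast0AtMost)
  finally have c: "(\<Sum>k=0..n. 1 / fact k * (1 / fact (n - k)) * (a ^ k * b ^ (n - k))) =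
    1 / fact n * (a + b) ^ n" .
  have "(exp_lambda (a *\<^sub>C x) * exp_lambda (b *\<^sub>C x)) $ n =
      (\<Sum>k=0..n. (1 / fact k * (1 / fact (n - k)) * (a ^ k * b ^ (n - k))) *\<^sub>C x ^ n)"
    unfolding fps_mult_nth
    by (rule sum.cong)
      (simp_all add: exp_lambda_def scaleC_power mult_scaleC_left mult_scaleC_right scaleC_scaleC
        mult_ac flip: power_add)
  also have "\<dots> = exp_lambda ((a + b) *\<^sub>C x) $ n"
    by (simp only: complex_vector.scale_sum_left[symmetric] c)
      (simp add: exp_lambda_def scaleC_power scaleC_scaleC)
  finally show "(exp_lambda (a *\<^sub>C x) * exp_lambda (b *\<^sub>C x)) $ n = exp_lambda ((a + b) *\<^sub>C x) $ n" .
qed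

lemma exp_lambda_0: "exp_lambda (0 :: 'a::complex_algebra_1) = 1"
  by (simp add: exp_lambda_def fps_eq_iff power_0_left)

text \<open>Any other inverse z satisfies z = z (x y) = (z x) y = y, so the definite description
  picks out \<open>y\<close>.\<close>

lemma two_sided_inverse_eq:
  assumes "x * y = 1" "y * x = (1 :: 'a::ring_1)"
  shows "two_sided_inverse x = y"
  unfolding two_sided_inverse_def
proof (rule the_equality)
  fix z assume "x * z = 1 \<and> z * x = 1"
  then have "z = z * (x * y)" using assms by simp
  also have "\<dots> = y" using \<open>x * z = 1 \<and> z * x = 1\<close> by (simp flip: mult.assoc)
  finally show "z = y" .
qed (use assms in simp)

lemma two_sided_inverse_exp_lambda:
  "two_sided_inverse (exp_lambda (c *\<^sub>C x)) = exp_lambda (- c *\<^sub>C x)"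
  by (rule two_sided_inverse_eq) (simp_all only: exp_lambda_mult, simp_all add: exp_lambda_0)

section \<open>The flip of the two tensor legs\<close>

lemma clinear_tensor_flip: "clinear tensor_flip"
  and tensor_flip_tensor: "tensor_flip (a \<otimes> b) = b \<otimes> a"
proof -
  have B: "cbilinear (\<lambda>a b. b \<otimes> a)"
    by (simp add: cbilinear_def clinear_def cbilinearD[OF cbilinear_tensor])
  show "clinear tensor_flip"
    unfolding tensor_flip_def by (rule clinear_tensor_lift[OF B])
  show "tensor_flip (a \<otimes> b) = b \<otimes> a"
    by (simp add: tensor_flip_def tensor_lift_tensor[OF B])
qed

text \<open>A scalar can be absorbed into the left leg, so every tensor is a sum of pure tensors and
  no case for scalar multiples arises.\<close>

lemma tensor_induct [case_names tensor add]:
  assumes t: "\<And>a b. P (a \<otimes> b)" and a: "\<And>x y. P x \<Longrightarrow> P y \<Longrightarrow> P (x + y)"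
  shows "P x"
proof (induction x rule: tensor.abs_induct)
  case (1 p)
  show ?case
  proof (induction p rule: free_induct)
    case (single k c)
    obtain u v where k: "k = Simple u v" by (cases k)
    have "abs_tensor (Poly_Mapping.single k c) = c *\<^sub>C (u \<otimes> v)"
      by (simp add: k tensor.abs_eq scaleC_tensor.abs_eq free_tensor_def scaleC_single)
    also have "\<dots> = (c *\<^sub>C u) \<otimes> v" by (simp add: cbilinearD(3)[OF cbilinear_tensor])
    finally show ?case using t by simp
  qed (use a in \<open>simp flip: plus_tensor.abs_eq\<close>)
qed

lemma one_tensor_eq: "(1 :: ('a::complex_algebra_1, 'b::complex_algebra_1) tensor) = 1 \<otimes> 1"
  by transfer (rule tensor_rel_refl, simp add: free_tensor_def zero_simple_tensor_def flip: single_one)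

lemma tensor_flip_mult: "tensor_flip (x * y) = tensor_flip x * tensor_flip y"
proof (induction x rule: tensor_induct)
  case (tensor a b)
  show ?case
    by (induction y rule: tensor_induct)
      (simp_all add: tensor_mult tensor_flip_tensor distrib_left clinear_add[OF clinear_tensor_flip])
qed (simp add: distrib_right clinear_add[OF clinear_tensor_flip])

lemma tensor_flip_power: "tensor_flip (x ^ n) = tensor_flip x ^ n"
  by (induction n) (simp_all add: tensor_flip_mult one_tensor_eq tensor_flip_tensor)

lemma tensor_flip_exp_lambda: "fps_map tensor_flip (exp_lambda x) = exp_lambda (tensor_flip x)"
  by (simp add: fps_eq_iff exp_lambda_def clinear_scaleC[OF clinear_tensor_flip] tensor_flip_power)

section \<open>Powers of \<theta>^{ab} v_a \<otimes> w_b as sums over multi-indices\<close>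

lemma sum_multi_indices_Suc:
  "(\<Sum>as\<in>multi_indices r (Suc n). g as) = (\<Sum>a<r. \<Sum>as\<in>multi_indices r n. g (a # as))"
proof -
  have "multi_indices r (Suc n) = (\<lambda>(a, as). a # as) ` ({..<r} \<times> multi_indices r n)"
    by (auto simp: multi_indices_def length_Suc_conv image_iff)
  moreover have "inj_on (\<lambda>(a, as). a # as) ({..<r} \<times> multi_indices r n)"
    by (auto simp: inj_on_def)
  ultimately show ?thesis
    by (simp add: sum.reindex sum.cartesian_product o_def case_prod_unfold)
qed

text \<open>Pure tensors multiply leg by leg, so choosing a summand in each of the n factors spells
  one word in each leg, with letters in the order of the factors. The induction peels off the first
  letters.\<close>

lemma tensor_sum_power:
  fixes v :: "nat \<Rightarrow> 'a::complex_algebra_1" and w :: "nat \<Rightarrow> 'b::complex_algebra_1"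
  shows "(\<Sum>a<r. \<Sum>b<r. \<theta> a b *\<^sub>C (v a \<otimes> w b)) ^ n =
    (\<Sum>bs\<in>multi_indices r n. \<Sum>as\<in>multi_indices r n.
      (\<Prod>k<n. \<theta> (bs ! k) (as ! k)) *\<^sub>C (prod_list (map v bs) \<otimes> prod_list (map w as)))"
proof (induction n)
  case 0
  have "multi_indices r 0 = {[]}" by (auto simp: multi_indices_def)
  then show ?case by (simp flip: one_tensor_eq)
next
  case (Suc n)
  let ?T = "\<lambda>n bs as. (\<Prod>k<n. \<theta> (bs ! k) (as ! k)) *\<^sub>C (prod_list (map v bs) \<otimes> prod_list (map w as))"
  \<comment> \<open>The head entries contribute the factor of the new leftmost summand; the shift of
    the product index matches the tails to \<open>bs\<close> and \<open>as\<close>.\<close>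
  have T: "?T (Suc n) (b # bs) (a # as) = (\<theta> b a *\<^sub>C (v b \<otimes> w a)) * ?T n bs as" for a b bs as
    by (simp add: prod.lessThan_Suc_shift mult_scaleC_left mult_scaleC_right scaleC_scaleC tensor_mult
        mult.commute del: prod.lessThan_Suc)
  have "(\<Sum>bs\<in>multi_indices r (Suc n). \<Sum>as\<in>multi_indices r (Suc n). ?T (Suc n) bs as) =
      (\<Sum>b<r. \<Sum>bs\<in>multi_indices r n. \<Sum>a<r. \<Sum>as\<in>multi_indices r n.
        (\<theta> b a *\<^sub>C (v b \<otimes> w a)) * ?T n bs as)"
    unfolding sum_multi_indices_Suc T ..
  also have "\<dots> = (\<Sum>b<r. \<Sum>a<r. \<Sum>bs\<in>multi_indices r n. \<Sum>as\<in>multi_indices r n.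
        (\<theta> b a *\<^sub>C (v b \<otimes> w a)) * ?T n bs as)"
    by (intro sum.cong refl sum.swap)
  also have "\<dots> = (\<Sum>b<r. \<Sum>a<r. \<theta> b a *\<^sub>C (v b \<otimes> w a)) *
      (\<Sum>bs\<in>multi_indices r n. \<Sum>as\<in>multi_indices r n. ?T n bs as)"
    unfolding sum_distrib_right by (simp only: sum_distrib_left)
  finally show ?case by (simp only: Suc.IH power_Suc)
qed

lemma tensor_lift_tensor_sum_power:
  fixes v :: "nat \<Rightarrow> 'a::complex_algebra_1" and w :: "nat \<Rightarrow> 'b::complex_algebra_1"
  assumes "cbilinear B"
  shows "tensor_lift B ((\<Sum>a<r. \<Sum>b<r. \<theta> a b *\<^sub>C (v a \<otimes> w b)) ^ n) =
    (\<Sum>bs\<in>multi_indices r n. \<Sum>as\<in>multi_indices r n.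
      (\<Prod>k<n. \<theta> (bs ! k) (as ! k)) *\<^sub>C B (prod_list (map v bs)) (prod_list (map w as)))"
  by (simp add: tensor_sum_power clinear_sum[OF clinear_tensor_lift[OF assms]]
      clinear_scaleC[OF clinear_tensor_lift[OF assms]] tensor_lift_tensor[OF assms])

section \<open>Contraction of tensor series and \<lambda>-adic closure\<close>

text \<open>The exponential supplies \<lambda>^k with the scalar c^k / k!, and the value of
  \<open>B\<close> supplies the remaining n - k powers of \<lambda>.\<close>

lemma contract_exp_lambda_nth:
  assumes "cbilinear B"
  shows "contract B (exp_lambda (c *\<^sub>C x)) $ n =
    (\<Sum>k=0..n. (c ^ k / fact k) *\<^sub>C (tensor_lift B (x ^ k) $ (n - k)))"
  by (simp add: contract_def exp_lambda_def scaleC_power scaleC_scaleC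
      clinear_scaleC[OF clinear_tensor_lift[OF assms]])

text \<open>A complex scalar acts as a constant power series, so a span over power series absorbs
  it.\<close>

lemma span_scaleC: "x \<in> fps_module.span S \<Longrightarrow> c *\<^sub>C x \<in> fps_module.span S"
  by (simp add: fps_module.span_scale flip: fps_const_smult)

text \<open>The partial sums of \<lambda>^k times the contraction of \<open>T $ k\<close> lie in the
  span, and their coefficient in degree n is final from m = n on, which is \<lambda>-adic
  convergence.\<close>

lemma contract_in_closure_span:
  assumes "\<And>k. tensor_lift B (T $ k) \<in> fps_module.span S"
  shows "contract B T \<in> closure (fps_module.span S)"
proof -
  define s where "s = (\<lambda>m. \<Sum>k\<le>m. fps_X ^ k *\<^sub>\<lambda> tensor_lift B (T $ k))"
  have "s m \<in> fps_module.span S" for m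
    unfolding s_def by (intro fps_module.span_sum fps_module.span_scale assms)
  moreover have "s \<longlonglongrightarrow> contract B T"
  proof (rule tendsto_fpsI)
    fix n
    have "s m $ n = contract B T $ n" if "n \<le> m" for m
    proof -
      have "s m $ n = (\<Sum>k\<le>m. if n < k then 0 else tensor_lift B (T $ k) $ (n - k))"
        by (simp add: s_def fps_sum_nth fps_X_power_smult_nth)
      \<comment> \<open>Summands with k > n carry the factor \<lambda>^k and vanish in degree
        n.\<close>
      also have "\<dots> = (\<Sum>k=0..n. tensor_lift B (T $ k) $ (n - k))"
        by (rule sum.mono_neutral_cong_right) (use that in auto)
      finally show ?thesis by (simp add: contract_def)
    qed
    then show "\<forall>\<^sub>F m in sequentially. s m $ n = contract B T $ n"
      by (rule eventually_mono[OF eventually_ge_at_top])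
  qed
  ultimately show ?thesis
    unfolding closure_sequential by blast
qed

text \<open>Holds without any linearity in \<open>\<eta>\<close> and \<open>\<zeta>\<close>, because \<^const>\<open>tensor_lift\<close> is pointwise linear in
  the lifted map even when that map is not bilinear.\<close>

lemma clinear_twist_X: "clinear (twist_X \<F>)"
proof -
  define L where "L = (\<lambda>\<xi> \<eta> \<zeta>. fps_const \<eta> * fps_const \<xi> * twist_chi \<F> * fps_const (inv antipode \<zeta>))"
  have A: "L (\<xi> + \<xi>') \<eta> \<zeta> = L \<xi> \<eta> \<zeta> + L \<xi>' \<eta> \<zeta>" for \<xi> \<xi>' \<eta> \<zeta>
    by (simp add: L_def distrib_left distrib_right flip: fps_const_add)
  have S: "L (c *\<^sub>C \<xi>) \<eta> \<zeta> = c *\<^sub>C L \<xi> \<eta> \<zeta>" for c \<xi> \<eta> \<zeta>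
    by (simp add: L_def fps_eq_iff fps_mult_right_const_nth fps_mult_left_const_nth
        mult_scaleC_left mult_scaleC_right mult.assoc)
  have C: "case_simple_tensor (L (\<xi> + \<xi>')) k =
      case_simple_tensor (L \<xi>) k + case_simple_tensor (L \<xi>') k"
    "case_simple_tensor (L (c *\<^sub>C \<xi>)) k = c *\<^sub>C case_simple_tensor (L \<xi>) k" for \<xi> \<xi>' c k
    by (cases k; simp add: A S)+
  have "tensor_lift (L (\<xi> + \<xi>')) T = tensor_lift (L \<xi>) T + tensor_lift (L \<xi>') T"
    "tensor_lift (L (c *\<^sub>C \<xi>)) T = c *\<^sub>C tensor_lift (L \<xi>) T" for \<xi> \<xi>' c T
    by (simp_all add: tensor_lift_def lin_ext_def C
        scaleC_add_right scaleC_scaleC sum.distrib complex_vector.scale_sum_right mult.commute)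
  moreover have "twist_X \<F> \<xi> = contract (L \<xi>) (two_sided_inverse \<F>)" for \<xi>
    by (simp only: twist_X_def L_def)
  ultimately show ?thesis
    by (intro clinearI)
      (simp_all add: contract_def fps_eq_iff sum.distrib complex_vector.scale_sum_right)
qed

section \<open>Inverses of the abelian twist and of its R-matrix\<close>

lemma abelian_twist_inverse:
  "two_sided_inverse (abelian_twist r \<theta> V) =
    exp_lambda ((\<i> / 2) *\<^sub>C (\<Sum>a<r. \<Sum>b<r. \<theta> a b *\<^sub>C (uea_inj (V a) \<otimes> uea_inj (V b))))"
  unfolding abelian_twist_def two_sided_inverse_exp_lambda by simp

text \<open>Flipping the legs negates the exponent, so the flipped twist equals the inverse twist
  and the R-matrix is the square of the inverse twist.\<close>

lemma abelian_R_matrix_inverse: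
  assumes "\<And>a b. a < r \<Longrightarrow> b < r \<Longrightarrow> \<theta> b a = - \<theta> a b"
  shows "two_sided_inverse (R_matrix (abelian_twist r \<theta> V)) =
    exp_lambda ((- \<i>) *\<^sub>C (\<Sum>a<r. \<Sum>b<r. \<theta> a b *\<^sub>C (uea_inj (V a) \<otimes> uea_inj (V b))))"
proof -
  let ?x = "\<Sum>a<r. \<Sum>b<r. \<theta> a b *\<^sub>C (uea_inj (V a) \<otimes> uea_inj (V b))"
  have "tensor_flip ?x = (\<Sum>a<r. \<Sum>b<r. \<theta> a b *\<^sub>C (uea_inj (V b) \<otimes> uea_inj (V a)))"
    by (simp add: clinear_sum[OF clinear_tensor_flip] clinear_scaleC[OF clinear_tensor_flip]
        tensor_flip_tensor)
  \<comment> \<open>Exchanging the two sums puts the indices in the order in which antisymmetry of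
    \<theta> applies entry by entry.\<close>
  also have "\<dots> = (\<Sum>b<r. \<Sum>a<r. \<theta> a b *\<^sub>C (uea_inj (V b) \<otimes> uea_inj (V a)))"
    by (rule sum.swap)
  also have "\<dots> = (\<Sum>b<r. \<Sum>a<r. - (\<theta> b a *\<^sub>C (uea_inj (V b) \<otimes> uea_inj (V a))))"
  proof (intro sum.cong refl)
    fix a b assume "b \<in> {..<r}" "a \<in> {..<r}"
    then show "\<theta> a b *\<^sub>C (uea_inj (V b) \<otimes> uea_inj (V a)) =
        - (\<theta> b a *\<^sub>C (uea_inj (V b) \<otimes> uea_inj (V a)))"
      using assms[of b a] by simp
  qed
  finally have flip: "tensor_flip ?x = - ?x" by (simp add: sum_negf)
  have "fps_map tensor_flip (abelian_twist r \<theta> V) = exp_lambda ((\<i> / 2) *\<^sub>C ?x)"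
    by (simp add: abelian_twist_def tensor_flip_exp_lambda clinear_uminus[OF clinear_tensor_flip]
        clinear_scaleC[OF clinear_tensor_flip] flip)
  then have "R_matrix (abelian_twist r \<theta> V) = exp_lambda (\<i> *\<^sub>C ?x)"
    by (simp add: R_matrix_def abelian_twist_inverse exp_lambda_mult)
  then show ?thesis by (simp only: two_sided_inverse_exp_lambda)
qed

section \<open>Coefficients of the \<star>-bracket\<close>

text \<open>Here \<open>q\<close> counts the powers of \<lambda> coming from the inverse twist; the
  other n - q come from \<open>u\<close> and \<open>v\<close>. Words in the legs of the twist act as
  iterated brackets.\<close>

lemma star_bracket_abelian_nth:
  "star_bracket (abelian_twist r \<theta> V) u v $ n =
    (\<Sum>q=0..n. ((\<i> / 2) ^ q / fact q) *\<^sub>C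
      (\<Sum>bs\<in>multi_indices r q. \<Sum>as\<in>multi_indices r q. (\<Prod>k<q. \<theta> (bs ! k) (as ! k)) *\<^sub>C
        (fps_bilinear bracket (fps_map (foldr (\<lambda>b. bracket (V b)) bs) u)
          (fps_map (foldr (\<lambda>a. bracket (V a)) as) v) $ (n - q))))"
proof -
  have B: "cbilinear (\<lambda>\<xi> \<eta>. fps_bilinear bracket (fps_map (uea_act \<xi>) u) (fps_map (uea_act \<eta>) v))"
    by (rule cbilinear_compose[OF cbilinear_fps_bilinear[OF cbilinear_bracket]
          clinear_fps_map_uea_act clinear_fps_map_uea_act])
  show ?thesis
    by (simp add: star_bracket_def abelian_twist_inverse contract_exp_lambda_nth[OF B]
        tensor_lift_tensor_sum_power[OF B] fps_sum_nth uea_act_prod_list[abs_def])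
qed

lemma fps_map_const: "g 0 = 0 \<Longrightarrow> fps_map g (fps_const x) = fps_const (g x)"
  by (simp add: fps_eq_iff)

lemma foldr_bracket_0: "foldr (\<lambda>a. bracket (V a)) as 0 = 0"
  by (induction as) (simp_all add: cbilinearD[OF cbilinear_bracket])

text \<open>Constant arguments contribute no power of \<lambda>, so only \<open>q = n\<close>
  survives.\<close>

lemma star_bracket_abelian_const_nth:
  "star_bracket (abelian_twist r \<theta> V) (fps_const x) (fps_const y) $ n =
    ((\<i> / 2) ^ n / fact n) *\<^sub>C
      (\<Sum>bs\<in>multi_indices r n. \<Sum>as\<in>multi_indices r n. (\<Prod>k<n. \<theta> (bs ! k) (as ! k)) *\<^sub>C
        bracket (foldr (\<lambda>b. bracket (V b)) bs x) (foldr (\<lambda>a. bracket (V a)) as y))"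
  (is "_ = ?c n")
proof -
  have "star_bracket (abelian_twist r \<theta> V) (fps_const x) (fps_const y) $ n =
      (\<Sum>q=0..n. if q = n then ?c n else 0)"
    unfolding star_bracket_abelian_nth
    by (rule sum.cong)
      (auto simp: fps_map_const foldr_bracket_0 fps_bilinear_const[OF cbilinear_bracket])
  then show ?thesis by simp
qed

section \<open>Iterated brackets and the span of the basis over power series\<close>

lemma foldr_bracket_closed:
  assumes "\<And>a v. a < r \<Longrightarrow> v \<in> \<gg> \<Longrightarrow> bracket (V a) v \<in> \<gg>" "set as \<subseteq> {..<r}" "v \<in> \<gg>"
  shows "foldr (\<lambda>a. bracket (V a)) as v \<in> \<gg>"
  using assms(2) by (induction as) (simp_all add: assms)

text \<open>The head of the list is the outermost bracket. It acts on the expansion already obtained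
  for the tail, so its matrix is applied after those of the tail, as in the recursion for
  \<open>multi_const\<close>.\<close>

lemma foldr_bracket_multi_const:
  assumes "\<And>a i. a < r \<Longrightarrow> i < d \<Longrightarrow> bracket (V a) (t i) = (\<Sum>j<d. N a i j *\<^sub>C t j)"
    and "set as \<subseteq> {..<r}" "i < d"
  shows "foldr (\<lambda>a. bracket (V a)) as (t i) = (\<Sum>j<d. multi_const d N as i j *\<^sub>C t j)"
  using assms(2)
proof (induction as)
  case Nil
  have "(\<Sum>j<d. multi_const d N [] i j *\<^sub>C t j) = (\<Sum>j<d. if j = i then t j else 0)"
    by (rule sum.cong) auto
  then show ?case using \<open>i < d\<close> by simp
next
  case (Cons a as)
  then have "foldr (\<lambda>a. bracket (V a)) (a # as) (t i) =
      (\<Sum>k<d. multi_const d N as i k *\<^sub>C (\<Sum>j<d. N a k j *\<^sub>C t j))"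
    by (simp add: cbilinearD[OF cbilinear_bracket] assms(1))
  also have "\<dots> = (\<Sum>k<d. \<Sum>j<d. (multi_const d N as i k * N a k j) *\<^sub>C t j)"
    by (simp add: complex_vector.scale_sum_right scaleC_scaleC)
  also have "\<dots> = (\<Sum>j<d. \<Sum>k<d. (multi_const d N as i k * N a k j) *\<^sub>C t j)"
    by (rule sum.swap)
  finally show ?case by (simp add: complex_vector.scale_sum_left)
qed

text \<open>Finiteness of the basis is what makes the two sides agree: the coordinates of all
  coefficients refer to the same \<open>d\<close> vectors and assemble into \<open>d\<close> scalar
  series.\<close>

lemma lambda_span_const:
  assumes "is_basis d t \<gg>"
  shows "lambda_span d (\<lambda>i. fps_const (t i)) = {u. \<forall>n. u $ n \<in> \<gg>}"
proof (intro equalityI subsetI)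
  have \<gg>: "\<gg> = complex_vector.span (t ` {..<d})" and inj: "inj_on t {..<d}"
    using assms by (auto simp: is_basis_def)
  then have sub: "complex_vector.subspace \<gg>" and t: "i < d \<Longrightarrow> t i \<in> \<gg>" for i
    by (auto intro: complex_vector.span_base)
  {
    fix u assume "u \<in> lambda_span d (\<lambda>i. fps_const (t i))"
    then show "u \<in> {u. \<forall>n. u $ n \<in> \<gg>}"
      unfolding lambda_span_def
    proof (induction rule: fps_module.span_induct_alt)
      case base
      then show ?case by (simp add: complex_vector.subspace_0[OF sub])
    next
      case (step c x y)
      then show ?case
        by (auto simp: fps_smult_const_right_nth t
            intro!: complex_vector.subspace_add[OF sub] complex_vector.subspace_scale[OF sub])
    qed
  }
  fix u assume u: "u \<in> {u. \<forall>n. u $ n \<in> \<gg>}"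
  have "\<exists>c. u $ n = (\<Sum>i<d. c i *\<^sub>C t i)" for n
  proof -
    have "u $ n \<in> complex_vector.span (t ` {..<d})" using u \<gg> by auto
    then obtain e where "u $ n = (\<Sum>x\<in>t ` {..<d}. e x *\<^sub>C x)"
      by (auto simp: complex_vector.span_finite)
    then show ?thesis by (auto simp: sum.reindex[OF inj])
  qed
  then obtain c where c: "\<And>n. u $ n = (\<Sum>i<d. c n i *\<^sub>C t i)" by metis
  \<comment> \<open>For each basis vector, its coordinates in all degrees become the coefficients of
    one scalar series.\<close>
  have "u = (\<Sum>i<d. Abs_fps (\<lambda>n. c n i) *\<^sub>\<lambda> fps_const (t i))"
    by (simp add: fps_eq_iff fps_sum_nth fps_smult_const_right_nth c)
  also have "\<dots> \<in> lambda_span d (\<lambda>i. fps_const (t i))"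
    unfolding lambda_span_def
    by (intro fps_module.span_sum fps_module.span_scale fps_module.span_base imageI)
  finally show "u \<in> lambda_span d (\<lambda>i. fps_const (t i))" .
qed

section \<open>Closure under the \<star>-bracket and the coproduct\<close>

text \<open>Each coefficient is a finite combination of brackets of two iterated brackets, and both
  of these stay in \<gg>.\<close>

lemma star_bracket_abelian_closed:
  assumes g: "lie_subalgebra \<gg>"
    and V: "\<And>a v. a < r \<Longrightarrow> v \<in> \<gg> \<Longrightarrow> bracket (V a) v \<in> \<gg>"
    and u: "\<And>n. u $ n \<in> \<gg>" and v: "\<And>n. v $ n \<in> \<gg>"
  shows "star_bracket (abelian_twist r \<theta> V) u v $ n \<in> \<gg>"
proof -
  have sub: "complex_vector.subspace \<gg>" and br: "\<And>x y. x \<in> \<gg> \<Longrightarrow> y \<in> \<gg> \<Longrightarrow> bracket x y \<in> \<gg>"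
    using g by (auto simp: lie_subalgebra_def)
  show ?thesis
    unfolding star_bracket_abelian_nth fps_bilinear_nth fps_map_nth
    by (intro complex_vector.subspace_sum[OF sub] complex_vector.subspace_scale[OF sub] br
        foldr_bracket_closed[OF V] u v)
      (auto simp: multi_indices_def)
qed

text \<open>The second legs of the inverse R-matrix are words in the \<open>V a\<close> and act on
  \<open>u\<close> within \<gg>. The first legs only enter through \<open>twist_X\<close>, which may
  be any series. Each degree of the inverse R-matrix thus contracts into the span, and the whole
  series into its closure.\<close>

lemma star_coproduct_abelian:
  assumes anti: "\<And>a b. a < r \<Longrightarrow> b < r \<Longrightarrow> \<theta> b a = - \<theta> a b"
    and V: "\<And>a v. a < r \<Longrightarrow> v \<in> \<gg> \<Longrightarrow> bracket (V a) v \<in> \<gg>"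
    and u: "\<And>n. u $ n \<in> \<gg>"
  shows "\<exists>w\<in>completed_tensor UNIV (fps_map uea_inj ` {u. \<forall>n. u $ n \<in> \<gg>}).
    star_coproduct (abelian_twist r \<theta> V) u = fps_map uea_inj u \<otimes>\<^sub>\<lambda> 1 + w"
proof -
  let ?x = "\<Sum>a<r. \<Sum>b<r. \<theta> a b *\<^sub>C (uea_inj (V a) \<otimes> uea_inj (V b))"
  let ?S = "{x \<otimes>\<^sub>\<lambda> y | x y. x \<in> UNIV \<and> y \<in> fps_map uea_inj ` {u. \<forall>n. u $ n \<in> \<gg>}}"
  define B where "B = (\<lambda>\<xi> \<eta>. twist_X (abelian_twist r \<theta> V) \<xi> \<otimes>\<^sub>\<lambda>
    fps_map uea_inj (fps_map (uea_act \<eta>) u))"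
  have B: "cbilinear B"
    unfolding B_def
    by (rule cbilinear_compose[OF cbilinear_fps_bilinear[OF cbilinear_tensor] clinear_twist_X
          clinear_compose[OF clinear_fps_map[OF clinear_uea_inj] clinear_fps_map_uea_act]])
  \<comment> \<open>The second factor is the iterated bracket applied to each coefficient of
    \<open>u\<close>, so the value is itself one of the generators in \<open>?S\<close>.\<close>
  have mem: "B \<xi> (prod_list (map (\<lambda>a. uea_inj (V a)) as)) \<in> fps_module.span ?S"
    if "set as \<subseteq> {..<r}" for \<xi> as
    unfolding B_def
    by (rule fps_module.span_base)
      (use foldr_bracket_closed[OF V that] u in \<open>force simp: uea_act_prod_list\<close>)
  have "tensor_lift B (exp_lambda ((- \<i>) *\<^sub>C ?x) $ k) \<in> fps_module.span ?S" for k
  proof -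
    have "tensor_lift B (?x ^ k) \<in> fps_module.span ?S"
      unfolding tensor_lift_tensor_sum_power[OF B]
      by (intro fps_module.span_sum span_scaleC mem) (auto simp: multi_indices_def)
    then show ?thesis
      by (simp add: exp_lambda_def scaleC_power clinear_scaleC[OF clinear_tensor_lift[OF B]]
          span_scaleC del: complex_vector.scale_minus_left)
  qed
  then have "contract B (exp_lambda ((- \<i>) *\<^sub>C ?x)) \<in>
      completed_tensor UNIV (fps_map uea_inj ` {u. \<forall>n. u $ n \<in> \<gg>})"
    unfolding completed_tensor_def by (rule contract_in_closure_span)
  moreover have "two_sided_inverse (R_matrix (abelian_twist r \<theta> V)) = exp_lambda ((- \<i>) *\<^sub>C ?x)"
    by (rule abelian_R_matrix_inverse) (rule anti)
  then have "star_coproduct (abelian_twist r \<theta> V) u =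
      fps_map uea_inj u \<otimes>\<^sub>\<lambda> 1 + contract B (exp_lambda ((- \<i>) *\<^sub>C ?x))"
    by (simp only: star_coproduct_def B_def)
  ultimately show ?thesis by (rule bexI[rotated])
qed

section \<open>The deformed structure constants\<close>

text \<open>All multi-indices of length n carry the same \<lambda>^n and the same 1 / n!, so the
  n-th term is a monomial. The series of these terms is then the expansion of a formal power series
  in its own monomials.\<close>

lemma star_const_term_eq:
  "star_const_term r \<theta> d N f i j m n = fps_const ((\<i> / 2) ^ n / fact n *
    (\<Sum>bs\<in>multi_indices r n. \<Sum>as\<in>multi_indices r n. (\<Prod>k<n. \<theta> (bs ! k) (as ! k)) *
      (\<Sum>k<d. \<Sum>l<d. multi_const d N bs i k * multi_const d N as j l * f k l m))) * fps_X ^ n"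
  (is "_ = ?rhs")
proof (rule fps_ext)
  fix q
  have "multi_theta \<theta> bs as = fps_const ((\<i> / 2) ^ n / fact n * (\<Prod>k<n. \<theta> (bs ! k) (as ! k))) * fps_X ^ n"
    if "as \<in> multi_indices r n" for bs as
    using that
    by (simp add: fps_eq_iff multi_theta_def multi_indices_def power_mult_distrib fps_const_power)
  then have "star_const_term r \<theta> d N f i j m n =
    (\<Sum>bs\<in>multi_indices r n. \<Sum>as\<in>multi_indices r n. \<Sum>k<d. \<Sum>l<d.
      fps_const ((\<i> / 2) ^ n / fact n * (\<Prod>k<n. \<theta> (bs ! k) (as ! k))) * fps_X ^ n *
      fps_const (multi_const d N bs i k * multi_const d N as j l * f k l m))"
    unfolding star_const_term_def by (intro sum.cong refl) simp
  then show "star_const_term r \<theta> d N f i j m n $ q = ?rhs $ q"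
    by (simp add: fps_sum_nth sum_distrib_left mult_ac)
qed

lemma sums_monomials: "(\<lambda>n. fps_const (c n) * fps_X ^ n) sums Abs_fps c"
  for c :: "nat \<Rightarrow> 'a::comm_ring_1"
  using fps_notation[of "Abs_fps c"] by (simp add: sums_def_le atLeast0AtMost)

text \<open>Both iterated brackets are expanded in the basis, the structure constants of \<gg>
  evaluate the outer bracket, and the coefficients of each \<open>t m\<close> are collected.\<close>

lemma star_bracket_abelian_basis_nth:
  assumes f: "\<And>i j. i < d \<Longrightarrow> j < d \<Longrightarrow> bracket (t i) (t j) = (\<Sum>k<d. f i j k *\<^sub>C t k)"
    and N: "\<And>a i. a < r \<Longrightarrow> i < d \<Longrightarrow> bracket (V a) (t i) = (\<Sum>j<d. N a i j *\<^sub>C t j)"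
    and ij: "i < d" "j < d"
  shows "star_bracket (abelian_twist r \<theta> V) (fps_const (t i)) (fps_const (t j)) $ n =
    (\<Sum>m<d. ((\<i> / 2) ^ n / fact n *
      (\<Sum>bs\<in>multi_indices r n. \<Sum>as\<in>multi_indices r n. (\<Prod>k<n. \<theta> (bs ! k) (as ! k)) *
        (\<Sum>k<d. \<Sum>l<d. multi_const d N bs i k * multi_const d N as j l * f k l m))) *\<^sub>C t m)"
proof -
  have "bracket (foldr (\<lambda>b. bracket (V b)) bs (t i)) (foldr (\<lambda>a. bracket (V a)) as (t j)) =
      (\<Sum>m<d. (\<Sum>k<d. \<Sum>l<d. multi_const d N bs i k * multi_const d N as j l * f k l m) *\<^sub>C t m)"
    if "bs \<in> multi_indices r n" "as \<in> multi_indices r n" for bs as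
  proof -
    have "foldr (\<lambda>b. bracket (V b)) bs (t i) = (\<Sum>j<d. multi_const d N bs i j *\<^sub>C t j)"
      "foldr (\<lambda>a. bracket (V a)) as (t j) = (\<Sum>l<d. multi_const d N as j l *\<^sub>C t l)"
      using that ij by (auto intro!: foldr_bracket_multi_const[where V = V, OF N] simp: multi_indices_def)
    then have "bracket (foldr (\<lambda>b. bracket (V b)) bs (t i)) (foldr (\<lambda>a. bracket (V a)) as (t j)) =
        (\<Sum>k<d. \<Sum>l<d. \<Sum>m<d. (multi_const d N bs i k * multi_const d N as j l * f k l m) *\<^sub>C t m)"
      by (simp add: cbilinear_sum_sum[OF cbilinear_bracket] f complex_vector.scale_sum_right
          scaleC_scaleC)
    also have "\<dots> = (\<Sum>k<d. \<Sum>m<d. \<Sum>l<d. (multi_const d N bs i k * multi_const d N as j l * f k l m) *\<^sub>C t m)"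
      by (intro sum.cong refl sum.swap)
    also have "\<dots> = (\<Sum>m<d. \<Sum>k<d. \<Sum>l<d. (multi_const d N bs i k * multi_const d N as j l * f k l m) *\<^sub>C t m)"
      by (rule sum.swap)
    finally show ?thesis by (simp add: complex_vector.scale_sum_left)
  qed
  then have "star_bracket (abelian_twist r \<theta> V) (fps_const (t i)) (fps_const (t j)) $ n =
    ((\<i> / 2) ^ n / fact n) *\<^sub>C
      (\<Sum>bs\<in>multi_indices r n. \<Sum>as\<in>multi_indices r n. \<Sum>m<d. ((\<Prod>k<n. \<theta> (bs ! k) (as ! k)) *
        (\<Sum>k<d. \<Sum>l<d. multi_const d N bs i k * multi_const d N as j l * f k l m)) *\<^sub>C t m)"
    unfolding star_bracket_abelian_const_nth
    by (simp add: complex_vector.scale_sum_right scaleC_scaleC)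
  \<comment> \<open>The sum over \<open>m\<close> moves outwards, first past \<open>as\<close> and
    then past \<open>bs\<close>, until the scalars in front of \<open>t m\<close> stand
    together.\<close>
  also have "\<dots> = ((\<i> / 2) ^ n / fact n) *\<^sub>C
      (\<Sum>bs\<in>multi_indices r n. \<Sum>m<d. \<Sum>as\<in>multi_indices r n. ((\<Prod>k<n. \<theta> (bs ! k) (as ! k)) *
        (\<Sum>k<d. \<Sum>l<d. multi_const d N bs i k * multi_const d N as j l * f k l m)) *\<^sub>C t m)"
    by (subst sum.swap[where B = "{..<d}"]) (rule refl)
  also have "\<dots> = ((\<i> / 2) ^ n / fact n) *\<^sub>C
      (\<Sum>m<d. \<Sum>bs\<in>multi_indices r n. \<Sum>as\<in>multi_indices r n. ((\<Prod>k<n. \<theta> (bs ! k) (as ! k)) *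
        (\<Sum>k<d. \<Sum>l<d. multi_const d N bs i k * multi_const d N as j l * f k l m)) *\<^sub>C t m)"
    by (subst sum.swap[where B = "{..<d}"]) (rule refl)
  finally show ?thesis
    by (simp only: complex_vector.scale_sum_left[symmetric] complex_vector.scale_sum_right scaleC_scaleC)
qed

section \<open>The deformed subalgebra with undeformed generators\<close>

theorem proposition2:
  fixes V :: "nat \<Rightarrow> 'm::smooth_manifold vector_field"
    and \<theta> :: "nat \<Rightarrow> nat \<Rightarrow> complex"
    and \<gg> :: "'m vector_field set"
    and t :: "nat \<Rightarrow> 'm vector_field"
    and f N :: "nat \<Rightarrow> nat \<Rightarrow> nat \<Rightarrow> complex"
    and r d :: nat
  assumes "\<And>a b. a < r \<Longrightarrow> b < r \<Longrightarrow> bracket (V a) (V b) = 0"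
    and "\<And>a b. a < r \<Longrightarrow> b < r \<Longrightarrow> \<theta> b a = - \<theta> a b"
    and "lie_subalgebra \<gg>"
    and "is_basis d t \<gg>"
    and "\<And>i j. i < d \<Longrightarrow> j < d \<Longrightarrow> bracket (t i) (t j) = (\<Sum>k<d. f i j k *\<^sub>C t k)"
    and "\<And>a v. a < r \<Longrightarrow> v \<in> \<gg> \<Longrightarrow> bracket (V a) v \<in> \<gg>"
    and "\<And>a i. a < r \<Longrightarrow> i < d \<Longrightarrow> bracket (V a) (t i) = (\<Sum>j<d. N a i j *\<^sub>C t j)"
  shows "star_lie_subalgebra (abelian_twist r \<theta> V) d t f (\<lambda>i. fps_const (t i)) \<and>
    lambda_span d (\<lambda>i. fps_const (t i)) = {u. \<forall>n. u $ n \<in> \<gg>} \<and>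
    (\<exists>f'. (\<forall>i<d. \<forall>j<d. \<forall>m<d. star_const_term r \<theta> d N f i j m sums f' i j m) \<and>
      (\<forall>i<d. \<forall>j<d. star_bracket (abelian_twist r \<theta> V) (fps_const (t i)) (fps_const (t j)) =
        (\<Sum>m<d. f' i j m *\<^sub>\<lambda> fps_const (t m)))) \<and>
    (\<forall>as i. set as \<subseteq> {..<r} \<longrightarrow> i < d \<longrightarrow>
      foldr (\<lambda>a. bracket (V a)) as (t i) = (\<Sum>j<d. multi_const d N as i j *\<^sub>C t j))"
proof -
  let ?\<F> = "abelian_twist r \<theta> V" and ?t = "\<lambda>i. fps_const (t i)"
  \<comment> \<open>\<open>g i j m n\<close> is the coefficient of \<lambda>^n in the deformed
    structure constant; the resulting series is the witness in both existential claims.\<close>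
  define g where "g = (\<lambda>i j m n. (\<i> / 2) ^ n / fact n *
    (\<Sum>bs\<in>multi_indices r n. \<Sum>as\<in>multi_indices r n. (\<Prod>k<n. \<theta> (bs ! k) (as ! k)) *
      (\<Sum>k<d. \<Sum>l<d. multi_const d N bs i k * multi_const d N as j l * f k l m)))"
  note span = lambda_span_const[OF assms(4)]
  have sums: "star_const_term r \<theta> d N f i j m sums Abs_fps (g i j m)" for i j m
    unfolding star_const_term_eq[abs_def] g_def by (rule sums_monomials)
  have br: "star_bracket ?\<F> (?t i) (?t j) = (\<Sum>m<d. Abs_fps (g i j m) *\<^sub>\<lambda> ?t m)"
    if "i < d" "j < d" for i j
    by (rule fps_ext)
      (simp add: fps_sum_nth fps_smult_const_right_nth g_def
        star_bracket_abelian_basis_nth[where V = V, OF assms(5,7) that])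
  \<comment> \<open>In order zero only the empty multi-indices occur and both matrix products are
    the identity, which leaves the undeformed constant.\<close>
  have g0: "g i j m 0 = f i j m" if "i < d" "j < d" for i j m
  proof -
    have "multi_indices r 0 = {[]}" by (auto simp: multi_indices_def)
    moreover have "(\<Sum>l<d. multi_const d N [] i k * multi_const d N [] j l * f k l m) =
        (\<Sum>l<d. if l = j then if k = i then f k j m else 0 else 0)" for k
      by (rule sum.cong) auto
    ultimately show ?thesis
      using that by (simp add: g_def del: multi_const.simps)
  qed
  have "star_lie_subalgebra ?\<F> d t f ?t"
    unfolding star_lie_subalgebra_def
  proof (intro conjI)
    show "\<forall>u\<in>lambda_span d ?t. \<forall>v\<in>lambda_span d ?t. star_bracket ?\<F> u v \<in> lambda_span d ?t"
      unfolding span by (intro ballI CollectI allI star_bracket_abelian_closed[OF assms(3,6)]) auto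
    show "\<exists>f'. \<forall>i<d. \<forall>j<d. star_bracket ?\<F> (?t i) (?t j) = (\<Sum>k<d. f' i j k *\<^sub>\<lambda> ?t k) \<and>
        (\<forall>k<d. f' i j k $ 0 = f i j k)"
      by (rule exI[of _ "\<lambda>i j k. Abs_fps (g i j k)"]) (simp add: br g0)
    show "\<forall>u\<in>lambda_span d ?t. \<exists>v\<in>lambda_span d ?t.
        \<exists>w\<in>completed_tensor UNIV (fps_map uea_inj ` lambda_span d ?t).
          star_coproduct ?\<F> u = fps_map uea_inj v \<otimes>\<^sub>\<lambda> 1 + w"
      unfolding span
    proof (intro ballI)
      fix u assume u: "u \<in> {u. \<forall>n. u $ n \<in> \<gg>}"
      then have "\<And>n. u $ n \<in> \<gg>" by simp
      \<comment> \<open>The component on the first summand of the coproduct is \<open>u\<close>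
        itself, so \<open>u\<close> serves as \<open>v\<close>.\<close>
      from star_coproduct_abelian[OF assms(2,6) this] u
      show "\<exists>v\<in>{u. \<forall>n. u $ n \<in> \<gg>}.
          \<exists>w\<in>completed_tensor UNIV (fps_map uea_inj ` {u. \<forall>n. u $ n \<in> \<gg>}).
            star_coproduct ?\<F> u = fps_map uea_inj v \<otimes>\<^sub>\<lambda> 1 + w"
        by (rule bexI)
    qed
  qed simp
  moreover have "\<exists>f'. (\<forall>i<d. \<forall>j<d. \<forall>m<d. star_const_term r \<theta> d N f i j m sums f' i j m) \<and>
      (\<forall>i<d. \<forall>j<d. star_bracket ?\<F> (?t i) (?t j) = (\<Sum>m<d. f' i j m *\<^sub>\<lambda> ?t m))"
    using sums br by (intro exI[of _ "\<lambda>i j m. Abs_fps (g i j m)"]) simp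
  moreover have "\<forall>as i. set as \<subseteq> {..<r} \<longrightarrow> i < d \<longrightarrow>
      foldr (\<lambda>a. bracket (V a)) as (t i) = (\<Sum>j<d. multi_const d N as i j *\<^sub>C t j)"
    by (intro allI impI foldr_bracket_multi_const[OF assms(7)])
  ultimately show ?thesis using span by (intro conjI)
qed

end
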